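(* Let $A$, $B$, $\mathbb{Y}$, $B_1$, $C_1$ and $C_1-B_1$ be positive stable matrices in $\mathbb{C}^{r\times r}$ such that $B_1C_1=C_1B_1$. Then for every $z\in\mathbb{C}$, $${}_1F_1^{(A,B;\mathbb{Y})}(B_1;C_1;z)=\exp(z)\;{}_1F_1^{(A,B;\mathbb{Y})}(C_1-B_1;C_1;-z).$$
   Context: A matrix in $\mathbb{C}^{r\times r}$ is positive stable if all its eigenvalues have positive real part; $I$ is the identity matrix. For $t>0$ and a square matrix $M$, $t^M=\exp(M\ln t)$. The Pochhammer symbol is $(M)_0=I$, $(M)_n=M(M+I)\cdots(M+(n-1)I)$ for $n\ge1$. For positive stable $B$ and a square matrix $W$, ${}_1F_1(A;B;W)=\sum_{n\ge0}(A)_n\,[(B)_n]^{-1}\,\frac{W^n}{n!}$. For commuting positive stable $P,Q$, the beta matrix function is $\mathfrak{B}(P,Q)=\Gamma(P)\Gamma(Q)\Gamma^{-1}(P+Q)=\int_0^1t^{P-I}(1-t)^{Q-I}dt$, where $\Gamma(P)=\int_0^\infty e^{-t}t^{P-I}dt$. For positive stable $A,B,P,Q,\mathbb{Y}$, $$\mathfrak{B}_{\mathbb{Y}}^{(A,B)}(P,Q)=\int_0^1 {}_1F_1\!\left(A;B;-\frac{\mathbb{Y}}{t(1-t)}\right)t^{P-I}(1-t)^{Q-I}\,dt .$$ The new extended confluent hypergeometric matrix function is $${}_1F_1^{(A,B;\mathbb{Y})}(B_1;C_1;z)=\sum_{n=0}^\infty \mathfrak{B}_{\mathbb{Y}}^{(A,B)}(B_1+nI,C_1-B_1)\,[\mathfrak{B}(B_1,C_1-B_1)]^{-1}\,\frac{z^n}{n!}.$$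 *)

theory Defs
  imports "HOL-Analysis.Analysis"
begin

text \<open>
  Matrices in C^(r x r) are elements of \<open>complex^'n^'n\<close> with \<open>r = CARD('n)\<close>.
  On this type the overloaded \<open>*\<close>, \<open>1\<close>, \<open>of_nat\<close>, \<open>^\<close> and \<open>pochhammer\<close> are entrywise, so the
  product is written \<open>**\<close>, the identity is \<open>mat 1\<close>, and the algebraic functions of a matrix
  are defined below. The series and integrals are taken in the normed space \<open>complex^'n^'n\<close>.
\<close>

definition eigenvalue :: "complex^'n^'n \<Rightarrow> complex \<Rightarrow> bool" where
  "eigenvalue M l \<longleftrightarrow> (\<exists>v. v \<noteq> 0 \<and> M *v v = l *s v)"

definition positive_stable :: "complex^'n^'n \<Rightarrow> bool" where
  "positive_stable M \<longleftrightarrow> (\<forall>l. eigenvalue M l \<longrightarrow> Re l > 0)"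

definition mscale :: "complex \<Rightarrow> complex^'n^'n \<Rightarrow> complex^'n^'n" (infixr "*\<^sub>M" 75) where
  "c *\<^sub>M M = (\<chi> i j. c * M $ i $ j)"

primrec mpower :: "complex^'n^'n \<Rightarrow> nat \<Rightarrow> complex^'n^'n" where
  "mpower M 0 = mat 1"
| "mpower M (Suc n) = mpower M n ** M"

definition mexp :: "complex^'n^'n \<Rightarrow> complex^'n^'n" where
  "mexp M = (\<Sum>n. (1 / fact n) *\<^sub>R mpower M n)"

text \<open>The value of \<open>mpowr t M\<close> is meaningful only for \<open>t > 0\<close>; in the integrals below the
  end points of the interval form a null set and do not matter.\<close>

definition mpowr :: "real \<Rightarrow> complex^'n^'n \<Rightarrow> complex^'n^'n" where
  "mpowr t M = mexp (ln t *\<^sub>R M)"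

primrec mpochhammer :: "complex^'n^'n \<Rightarrow> nat \<Rightarrow> complex^'n^'n" where
  "mpochhammer M 0 = mat 1"
| "mpochhammer M (Suc n) = mpochhammer M n ** (M + mat (of_nat n))"

definition hyp1F1 :: "complex^'n^'n \<Rightarrow> complex^'n^'n \<Rightarrow> complex^'n^'n \<Rightarrow> complex^'n^'n" where
  "hyp1F1 A B W =
     (\<Sum>n. mpochhammer A n ** matrix_inv (mpochhammer B n) ** ((1 / fact n) *\<^sub>R mpower W n))"

definition mGamma :: "complex^'n^'n \<Rightarrow> complex^'n^'n" where
  "mGamma P = integral {0..} (\<lambda>t. exp (- t) *\<^sub>R mpowr t (P - mat 1))"

definition mBeta :: "complex^'n^'n \<Rightarrow> complex^'n^'n \<Rightarrow> complex^'n^'n" where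
  "mBeta P Q = mGamma P ** mGamma Q ** matrix_inv (mGamma (P + Q))"

definition ext_mBeta ::
  "complex^'n^'n \<Rightarrow> complex^'n^'n \<Rightarrow> complex^'n^'n \<Rightarrow> complex^'n^'n \<Rightarrow> complex^'n^'n \<Rightarrow> complex^'n^'n"
where
  "ext_mBeta A B Y P Q =
     integral {0..1} (\<lambda>t. hyp1F1 A B (- ((1 / (t * (1 - t))) *\<^sub>R Y))
                            ** mpowr t (P - mat 1) ** mpowr (1 - t) (Q - mat 1))"

definition ext_hyp1F1 ::
  "complex^'n^'n \<Rightarrow> complex^'n^'n \<Rightarrow> complex^'n^'n \<Rightarrow> complex^'n^'n \<Rightarrow> complex^'n^'n \<Rightarrow> complex
    \<Rightarrow> complex^'n^'n"
where
  "ext_hyp1F1 A B Y B1 C1 z =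
     (\<Sum>n. (z ^ n / fact n) *\<^sub>M
        (ext_mBeta A B Y (B1 + mat (of_nat n)) (C1 - B1) ** matrix_inv (mBeta B1 (C1 - B1))))"

end

theory Submission
  imports Defs "HOL-Computational_Algebra.Fundamental_Theorem_Algebra"
begin

text \<open>
  With \<open>F(t) = \<^sub>1F\<^sub>1(A;B;-Y/(t(1-t))) t^(B1-I) (1-t)^(C1-B1-I)\<close>, summing the series under the integral
  turns the left-hand side into \<open>\<integral> e^(zt) F(t) dt\<close> times the inverse of the beta matrix, and,
  after \<open>t \<mapsto> 1-t\<close>, the right-hand side into \<open>e^z \<integral> e^(-z(1-t)) F(t) dt\<close> times the same inverse.

  The substance is that \<open>F\<close> is integrable, for which \<open>\<^sub>1F\<^sub>1(A;B;-sY)\<close> has to be bounded in \<open>s \<ge> 0\<close>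
  although \<open>A\<close>, \<open>B\<close> and \<open>Y\<close> need not commute. For \<open>D = B + mI\<close> with \<open>m\<close> large, the moments
  \<open>J\<^sub>n(M) = \<integral> u^(A+(n-1)I) (1-u)^(-A) M (1-u)^(D-I) du\<close> satisfy \<open>(A+nI) J\<^sub>n = J\<^sub>n\<^sub>+\<^sub>1 (D+nI)\<close>, so
  \<open>J\<^sub>n (D)\<^sub>n = (A)\<^sub>n J\<^sub>0\<close>; and \<open>M \<mapsto> J\<^sub>0(M)\<close> is injective because all moments vanish with \<open>J\<^sub>0\<close>, hence
  onto. Choosing \<open>J\<^sub>0(M) = (B)\<^sub>m\<^sup>-\<^sup>1\<close> gives \<open>(A)\<^sub>n (B)\<^sub>n\<^sup>-\<^sup>1 = J\<^sub>n(M) (B+nI)\<^sub>m\<close>, which represents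
  \<open>\<^sub>1F\<^sub>1(A;B;W)\<close> as an integral of the kernel against \<open>\<Sum>\<^sub>n (B+nI)\<^sub>m (uW)^n/n!\<close>, that is, against a
  polynomial in \<open>uW\<close> times \<open>e^(uW)\<close>, and the latter is bounded for \<open>W = -sY\<close>.
\<close>

section \<open>The matrix exponential\<close>

lemma bounded_bilinear_matrix_vector:
  "bounded_bilinear ((*v) :: complex^'n^'m \<Rightarrow> complex^'n \<Rightarrow> complex^'m)"
proof -
  have "bilinear ((*v) :: complex^'n^'m \<Rightarrow> complex^'n \<Rightarrow> complex^'m)"
    unfolding bilinear_def
    by (auto intro!: linearI simp: matrix_vector_mult_def vec_eq_iff sum.distrib algebra_simps scaleR_sum_right)
  then show ?thesis
    by (simp add: bilinear_conv_bounded_bilinear)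
qed

lemma bounded_bilinear_matrix_matrix:
  "bounded_bilinear ((**) :: complex^'n^'m \<Rightarrow> complex^'p^'n \<Rightarrow> complex^'p^'m)"
proof -
  have "bilinear ((**) :: complex^'n^'m \<Rightarrow> complex^'p^'n \<Rightarrow> complex^'p^'m)"
    unfolding bilinear_def
    by (auto intro!: linearI simp: matrix_matrix_mult_def vec_eq_iff sum.distrib algebra_simps scaleR_sum_right)
  then show ?thesis
    by (simp add: bilinear_conv_bounded_bilinear)
qed

interpretation mv: bounded_bilinear "(*v) :: complex^'n^'m \<Rightarrow> complex^'n \<Rightarrow> complex^'m"
  by (rule bounded_bilinear_matrix_vector)

interpretation mm: bounded_bilinear "(**) :: complex^'n^'m \<Rightarrow> complex^'p^'n \<Rightarrow> complex^'p^'m"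
  by (rule bounded_bilinear_matrix_matrix)

text \<open>
  On \<open>complex^'n^'n\<close> itself the overloaded product is entrywise, so the copy below carries the matrix
  product and the operator norm; it makes the library theory of \<open>exp\<close> in Banach algebras available.
\<close>

typedef 'n cmat = "UNIV :: (complex^'n^'n) set"
  morphisms of_cmat to_cmat by simp

setup_lifting type_definition_cmat

text \<open>Each entry is a coordinate of the image of a unit vector, hence bounded by the operator
  norm. The bound gives definiteness of the norm on \<open>cmat\<close> and one half of the
  equivalence of the two norms.\<close>

lemma norm_le_onorm_matrix:
  fixes M :: "complex^'n^'n"
  shows "norm M \<le> real (CARD('n) * CARD('n)) * onorm ((*v) M)"
proof -
  have *: "norm (M $ i $ j) \<le> onorm ((*v) M)" for i j
  proof -
    have "norm (M $ i $ j) = norm ((M *v axis j 1) $ i)"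
      by (simp add: matrix_vector_mult_def axis_def if_distrib cong: if_cong)
    also have "\<dots> \<le> norm (M *v axis j 1)"
      by (rule Finite_Cartesian_Product.norm_nth_le)
    also have "\<dots> \<le> onorm ((*v) M) * norm (axis j (1::complex))"
      by (rule onorm[OF mv.bounded_linear_right])
    finally show ?thesis by simp
  qed
  have "norm M \<le> (\<Sum>i\<in>UNIV. norm (M $ i))"
    unfolding norm_vec_def by (rule L2_set_le_sum) simp
  also have "\<dots> \<le> (\<Sum>i\<in>(UNIV::'n set). \<Sum>j\<in>(UNIV::'n set). norm (M $ i $ j))"
    unfolding norm_vec_def by (intro sum_mono L2_set_le_sum) simp
  also have "\<dots> \<le> (\<Sum>i\<in>(UNIV::'n set). \<Sum>j\<in>(UNIV::'n set). onorm ((*v) M))"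
    by (intro sum_mono *)
  finally show ?thesis by simp
qed

instantiation cmat :: (finite) real_normed_algebra_1
begin

lift_definition zero_cmat :: "'a cmat" is 0 .
lift_definition one_cmat :: "'a cmat" is "mat 1" .
lift_definition plus_cmat :: "'a cmat \<Rightarrow> 'a cmat \<Rightarrow> 'a cmat" is "(+)" .
lift_definition minus_cmat :: "'a cmat \<Rightarrow> 'a cmat \<Rightarrow> 'a cmat" is "(-)" .
lift_definition uminus_cmat :: "'a cmat \<Rightarrow> 'a cmat" is "uminus" .
lift_definition times_cmat :: "'a cmat \<Rightarrow> 'a cmat \<Rightarrow> 'a cmat" is "(**)" .
lift_definition scaleR_cmat :: "real \<Rightarrow> 'a cmat \<Rightarrow> 'a cmat" is "(*\<^sub>R)" .
lift_definition norm_cmat :: "'a cmat \<Rightarrow> real" is "\<lambda>M. onorm ((*v) M)" .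
definition dist_cmat :: "'a cmat \<Rightarrow> 'a cmat \<Rightarrow> real" where "dist_cmat x y = norm (x - y)"
definition sgn_cmat :: "'a cmat \<Rightarrow> 'a cmat" where "sgn_cmat x = inverse (norm x) *\<^sub>R x"
definition uniformity_cmat :: "('a cmat \<times> 'a cmat) filter"
  where "uniformity_cmat = (INF e\<in>{0<..}. principal {(x, y). dist x y < e})"
definition open_cmat :: "'a cmat set \<Rightarrow> bool"
  where "open_cmat U = (\<forall>x\<in>U. eventually (\<lambda>(x', y). x' = x \<longrightarrow> y \<in> U) uniformity)"

instance
proof
  fix x y z :: "'a cmat" and r s :: real
  show "x + y + z = x + (y + z)" by transfer simp
  show "x + y = y + x" by transfer simp
  show "0 + x = x" by transfer simp
  show "- x + x = 0" by transfer simp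
  show "x - y = x + - y" by transfer simp
  show "x * y * z = x * (y * z)" by transfer (simp add: matrix_mul_assoc)
  show "1 * x = x" by transfer simp
  show "x * 1 = x" by transfer simp
  show "(0::'a cmat) \<noteq> 1" by transfer (simp add: mat_def vec_eq_iff)
  show "(x + y) * z = x * z + y * z" by transfer (rule mm.add_left)
  show "x * (y + z) = x * y + x * z" by transfer (rule mm.add_right)
  show "r *\<^sub>R (x + y) = r *\<^sub>R x + r *\<^sub>R y" by transfer (rule scaleR_add_right)
  show "(r + s) *\<^sub>R x = r *\<^sub>R x + s *\<^sub>R x" by transfer (rule scaleR_add_left)
  show "r *\<^sub>R s *\<^sub>R x = (r * s) *\<^sub>R x" by transfer simp
  show "1 *\<^sub>R x = x" by transfer simp
  show "r *\<^sub>R x * y = r *\<^sub>R (x * y)" by transfer (rule mm.scaleR_left)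
  show "x * r *\<^sub>R y = r *\<^sub>R (x * y)" by transfer (rule mm.scaleR_right)
  show "dist x y = norm (x - y)" by (rule dist_cmat_def)
  show "sgn x = inverse (norm x) *\<^sub>R x" by (rule sgn_cmat_def)
  show "(uniformity :: ('a cmat \<times> 'a cmat) filter) = (INF e\<in>{0<..}. principal {(x, y). dist x y < e})"
    by (rule uniformity_cmat_def)
  show "open U = (\<forall>x\<in>U. eventually (\<lambda>(x', y). x' = x \<longrightarrow> y \<in> U) uniformity)" for U :: "'a cmat set"
    by (rule open_cmat_def)
  show "norm x = 0 \<longleftrightarrow> x = 0"
  proof (transfer, safe)
    fix M :: "complex^'a^'a"
    assume "onorm ((*v) M) = 0"
    then show "M = 0"
      using norm_le_onorm_matrix[of M] by simp
  qed (simp add: onorm_eq_0 mv.bounded_linear_right mv.zero_left)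
  show "norm (x + y) \<le> norm x + norm y"
  proof transfer
    fix M N :: "complex^'a^'a"
    have "(*v) (M + N) = (\<lambda>v. M *v v + N *v v)"
      by (simp add: fun_eq_iff mv.add_left)
    then show "onorm ((*v) (M + N)) \<le> onorm ((*v) M) + onorm ((*v) N)"
      by (simp add: onorm_triangle mv.bounded_linear_right)
  qed
  show "norm (r *\<^sub>R x) = \<bar>r\<bar> * norm x"
  proof transfer
    fix r and M :: "complex^'a^'a"
    have "(*v) (r *\<^sub>R M) = (\<lambda>v. r *\<^sub>R (M *v v))"
      by (simp add: fun_eq_iff mv.scaleR_left)
    then show "onorm ((*v) (r *\<^sub>R M)) = \<bar>r\<bar> * onorm ((*v) M)"
      by (simp add: onorm_scaleR mv.bounded_linear_right)
  qed
  show "norm (x * y) \<le> norm x * norm y"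
  proof transfer
    fix M N :: "complex^'a^'a"
    have "(*v) (M ** N) = (*v) M \<circ> (*v) N"
      by (auto simp: matrix_vector_mul_assoc)
    then show "onorm ((*v) (M ** N)) \<le> onorm ((*v) M) * onorm ((*v) N)"
      by (simp add: onorm_compose mv.bounded_linear_right)
  qed
  show "norm (1::'a cmat) = 1"
  proof transfer
    have "(*v) (mat 1 :: complex^'a^'a) = (\<lambda>v. v)"
      by (simp add: fun_eq_iff)
    then show "onorm ((*v) (mat 1 :: complex^'a^'a)) = 1"
      by (simp add: onorm_id)
  qed
qed

end

text \<open>Together with \<open>bounded_linear_to_cmat\<close> this makes the operator norm
  equivalent to the norm of \<open>complex^'n^'n\<close>, so that limits, series and derivatives
  pass between the two types.\<close>

lemma bounded_linear_of_cmat: "bounded_linear (of_cmat :: 'n::finite cmat \<Rightarrow> _)"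
proof (rule bounded_linear_intro)
  show "norm (of_cmat x) \<le> norm x * real (CARD('n) * CARD('n))" for x :: "'n cmat"
    using norm_le_onorm_matrix[of "of_cmat x"]
    by (simp add: norm_cmat.rep_eq mult.commute)
qed (simp_all add: plus_cmat.rep_eq scaleR_cmat.rep_eq)

lemma bounded_linear_to_cmat: "bounded_linear (to_cmat :: _ \<Rightarrow> 'n::finite cmat)"
proof -
  obtain K where K: "\<And>(M :: complex^'n^'n) x. norm (M *v x) \<le> norm M * norm x * K" "K \<ge> 0"
    using mv.nonneg_bounded by blast
  show ?thesis
  proof (rule bounded_linear_intro)
    show "norm (to_cmat M :: 'n cmat) \<le> norm M * K" for M
      unfolding norm_cmat.abs_eq
      by (rule onorm_bound) (use K in \<open>auto simp: mult.assoc mult.left_commute mult.commute\<close>)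
  qed (simp_all add: plus_cmat.abs_eq scaleR_cmat.abs_eq)
qed

instance cmat :: (finite) banach
proof
  fix X :: "nat \<Rightarrow> 'a cmat"
  assume "Cauchy X"
  then have "Cauchy (\<lambda>n. of_cmat (X n))"
    by (rule bounded_linear.Cauchy[OF bounded_linear_of_cmat])
  then obtain L where "(\<lambda>n. of_cmat (X n)) \<longlonglongrightarrow> L"
    using Cauchy_convergent_iff convergent_def by blast
  then have "(\<lambda>n. to_cmat (of_cmat (X n))) \<longlonglongrightarrow> to_cmat L"
    by (rule bounded_linear.tendsto[OF bounded_linear_to_cmat])
  then show "convergent X"
    by (auto simp: of_cmat_inverse convergent_def)
qed

lemma of_cmat_power: "of_cmat (x ^ n) = mpower (of_cmat x) n"
  by (induction n) (simp_all add: one_cmat.rep_eq power_Suc2 times_cmat.rep_eq del: power_Suc)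

lemma sums_mexp: "(\<lambda>n. (1 / fact n) *\<^sub>R mpower M n) sums mexp M"
  and of_cmat_exp: "of_cmat (exp (to_cmat M)) = mexp M"
proof -
  have "(\<lambda>n. of_cmat (to_cmat M ^ n /\<^sub>R fact n)) sums of_cmat (exp (to_cmat M))"
    by (rule bounded_linear.sums[OF bounded_linear_of_cmat exp_converges])
  then have "(\<lambda>n. (1 / fact n) *\<^sub>R mpower M n) sums of_cmat (exp (to_cmat M))"
    by (simp add: scaleR_cmat.rep_eq of_cmat_power to_cmat_inverse inverse_eq_divide)
  moreover from this have "mexp M = of_cmat (exp (to_cmat M))"
    unfolding mexp_def by (rule sums_unique[symmetric])
  ultimately show "(\<lambda>n. (1 / fact n) *\<^sub>R mpower M n) sums mexp M"
    and "of_cmat (exp (to_cmat M)) = mexp M" by simp_all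
qed

lemma to_cmat_mult: "to_cmat (M ** N) = to_cmat M * to_cmat N"
  by (simp add: times_cmat.abs_eq)

lemma mexp_add_commute:
  assumes "A ** B = B ** A"
  shows "mexp (A + B) = mexp A ** mexp B"
proof -
  have "exp (to_cmat (A + B)) = exp (to_cmat A) * exp (to_cmat B)"
    unfolding plus_cmat.abs_eq[symmetric]
    by (rule exp_add_commuting) (simp add: assms flip: to_cmat_mult)
  then show ?thesis
    by (metis of_cmat_exp times_cmat.rep_eq)
qed

lemma mexp_zero [simp]: "mexp 0 = mat 1"
  by (metis exp_zero of_cmat_exp one_cmat.rep_eq zero_cmat.abs_eq)

lemma mpower_commute:
  assumes "A ** B = B ** A"
  shows "mpower A n ** B = B ** mpower A n"
proof (induction n)
  case (Suc n)
  then show ?case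
    by (metis assms matrix_mul_assoc mpower.simps(2))
qed simp

lemma mexp_commute:
  assumes "A ** B = B ** A"
  shows "mexp A ** B = B ** mexp A"
proof -
  have "(\<lambda>n. ((1 / fact n) *\<^sub>R mpower A n) ** B) sums (mexp A ** B)"
    by (rule bounded_linear.sums[OF mm.bounded_linear_left sums_mexp]) 
  moreover have "(\<lambda>n. B ** ((1 / fact n) *\<^sub>R mpower A n)) sums (B ** mexp A)"
    by (rule bounded_linear.sums[OF mm.bounded_linear_right sums_mexp])
  ultimately show ?thesis
    by (simp add: mm.scaleR_left mm.scaleR_right mpower_commute[OF assms] sums_unique2)
qed

lemma mexp_scaleR_has_vector_derivative:
  "((\<lambda>s. mexp (s *\<^sub>R M)) has_vector_derivative M ** mexp (s *\<^sub>R M)) (at s within S)"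
proof -
  have "((\<lambda>s. of_cmat (exp (s *\<^sub>R to_cmat M))) has_vector_derivative
          of_cmat (to_cmat M * exp (s *\<^sub>R to_cmat M))) (at s within S)"
    by (intro bounded_linear.has_vector_derivative[OF bounded_linear_of_cmat]
        has_vector_derivative_at_within[OF exp_scaleR_has_vector_derivative_left])
  then show ?thesis
    by (simp add: scaleR_cmat.abs_eq of_cmat_exp times_cmat.rep_eq to_cmat_inverse)
qed

text \<open>A crude growth bound, with \<open>L\<close> the operator norm of \<open>M\<close>. It is
  used later with \<open>s = - ln t\<close>, where it becomes a power bound for
  \<open>mpowr\<close>.\<close>

lemma mexp_exponential_bound:
  obtains C L where "C \<ge> 0" "L \<ge> 0" "\<And>s. s \<ge> 0 \<Longrightarrow> norm (mexp (s *\<^sub>R M)) \<le> C * exp (L * s)"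
proof -
  obtain K where K: "\<And>x::'a cmat. norm (of_cmat x) \<le> norm x * K" "K \<ge> 0"
    using bounded_linear.nonneg_bounded[OF bounded_linear_of_cmat] by blast
  have "norm (mexp (s *\<^sub>R M)) \<le> K * exp (norm (to_cmat M) * s)" if "s \<ge> 0" for s
  proof -
    have "norm (mexp (s *\<^sub>R M)) \<le> norm (exp (s *\<^sub>R to_cmat M)) * K"
      using K(1)[of "exp (s *\<^sub>R to_cmat M)"] by (simp add: scaleR_cmat.abs_eq of_cmat_exp)
    also have "\<dots> \<le> exp (norm (s *\<^sub>R to_cmat M)) * K"
      by (intro mult_right_mono norm_exp K)
    finally show ?thesis using that by (simp add: mult.commute)
  qed
  then show ?thesis using K(2) that[of K "norm (to_cmat M)"] by simp
qed

lemma summable_norm_mexp: "summable (\<lambda>n. norm ((1 / fact n) *\<^sub>R mpower M n))"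
proof -
  obtain K where K: "\<And>x::'a cmat. norm (of_cmat x) \<le> norm x * K"
    using bounded_linear.nonneg_bounded[OF bounded_linear_of_cmat] by blast
  have *: "(1 / fact n) *\<^sub>R mpower M n = of_cmat (to_cmat M ^ n /\<^sub>R fact n)" for n
    by (simp add: scaleR_cmat.rep_eq of_cmat_power to_cmat_inverse inverse_eq_divide)
  show ?thesis
  proof (rule summable_comparison_test')
    show "summable (\<lambda>n. norm (to_cmat M ^ n /\<^sub>R fact n) * K)"
      by (rule summable_mult2[OF summable_norm_exp])
    show "norm (norm ((1 / fact n) *\<^sub>R mpower M n)) \<le> norm (to_cmat M ^ n /\<^sub>R fact n) * K" if "n \<ge> 0" for n
      unfolding * real_norm_def abs_norm_cancel by (rule K)
  qed
qed

section \<open>Exponential decay of positive stable matrices\<close>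

lemma norm_mscale: "norm (c *\<^sub>M M) = norm c * norm M"
  by (simp add: mscale_def norm_vec_def norm_mult L2_set_right_distrib)

lemma bounded_bilinear_mscale: "bounded_bilinear (*\<^sub>M)"
proof
  show "\<exists>K. \<forall>c (M::complex^'a^'a). norm (c *\<^sub>M M) \<le> norm c * norm M * K"
    by (rule exI[of _ 1]) (simp add: norm_mscale)
qed (auto simp: mscale_def vec_eq_iff algebra_simps)

interpretation ms: bounded_bilinear "(*\<^sub>M)"
  by (rule bounded_bilinear_mscale)

lemma mscale_mult_left: "(c *\<^sub>M A) ** B = c *\<^sub>M (A ** B)"
  and mscale_mult_right: "A ** (c *\<^sub>M B) = c *\<^sub>M (A ** B)"
  by (simp_all add: mscale_def matrix_matrix_mult_def vec_eq_iff sum_distrib_left mult_ac)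

lemma mscale_mscale [simp]: "a *\<^sub>M b *\<^sub>M A = (a * b) *\<^sub>M A"
  by (simp add: mscale_def mult.assoc)

lemma mscale_of_real: "complex_of_real r *\<^sub>M A = r *\<^sub>R A"
  by (simp add: mscale_def vec_eq_iff) (simp add: scaleR_conv_of_real)

lemma mscale_one [simp]: "1 *\<^sub>M A = A"
  by (simp add: mscale_def)

lemma mat_mult_left: "mat c ** A = c *\<^sub>M A"
  and mat_mult_right: "A ** mat c = c *\<^sub>M A"
  by (simp_all add: mat_def mscale_def matrix_matrix_mult_def vec_eq_iff if_distrib if_distribR mult.commute cong: if_cong)

lemma mat_vector_mult: "mat c *v v = c *s v"
  by (simp add: mat_def matrix_vector_mult_def vec_eq_iff if_distrib if_distribR cong: if_cong)

lemma eigenvalue_iff_kernel: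
  "eigenvalue M l \<longleftrightarrow> (\<exists>v. v \<noteq> 0 \<and> (M - mat l) *v v = 0)"
  by (simp add: eigenvalue_def mv.diff_left mat_vector_mult)

lemma obtain_inverse_if_not_eigenvalue:
  assumes "\<not> eigenvalue M l"
  obtains R where "R ** (M - mat l) = mat 1"
  using assms matrix_left_invertible_ker[of "M - mat l"] by (auto simp: eigenvalue_iff_kernel)

section \<open>Polynomials evaluated at a matrix, and an annihilating polynomial\<close>

definition mpoly :: "complex poly \<Rightarrow> complex^'n^'n \<Rightarrow> complex^'n^'n" where
  "mpoly p P = fold_coeffs (\<lambda>a N. mat a + P ** N) p 0"

lemma mat_0 [simp]: "mat 0 = (0 :: 'a::zero^'n^'n)"
  by (simp add: mat_def vec_eq_iff)

lemma mpoly_0 [simp]: "mpoly 0 P = 0"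
  by (simp add: mpoly_def)

lemma mpoly_pCons: "mpoly (pCons a p) P = mat a + P ** mpoly p P"
  by (cases "p = 0 \<and> a = 0") (auto simp: mpoly_def mm.zero_right)

lemma mat_add: "mat (a + b) = mat a + (mat b :: 'a::monoid_add^'n^'n)"
  by (simp add: mat_def vec_eq_iff)

lemma mpoly_add: "mpoly (p + q) P = mpoly p P + mpoly q P"
  by (induction p q rule: poly_induct2) (simp_all add: mpoly_pCons mat_add mm.add_right)

lemma mpoly_sum: "mpoly (\<Sum>i\<in>I. p i) P = (\<Sum>i\<in>I. mpoly (p i) P)"
  by (induction I rule: infinite_finite_induct) (simp_all add: mpoly_add)

lemma mpoly_smult: "mpoly (smult c p) P = c *\<^sub>M mpoly p P"
proof (induction p)
  case (pCons a p)
  then show ?case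
    by (simp add: mpoly_pCons ms.add_right mscale_mult_right) (simp add: mat_def mscale_def vec_eq_iff)
qed (simp add: ms.zero_right)

lemma mpoly_linear_factor: "mpoly ([:- l, 1:] * p) P = (P - mat l) ** mpoly p P"
proof -
  have "[:- l, 1:] * p = smult (- l) p + pCons 0 p"
    by simp
  then show ?thesis
    by (simp only: mpoly_add mpoly_smult mpoly_pCons) (simp add: mm.diff_left mat_mult_left ms.minus_left)
qed

lemma mpoly_monom: "mpoly (monom c n) P = c *\<^sub>M mpower P n"
proof (induction n)
  case 0
  then show ?case by (simp add: monom_0 mpoly_pCons mm.zero_right) (metis mat_mult_left matrix_mul_rid)
next
  case (Suc n)
  then show ?case
    by (simp add: monom_Suc mpoly_pCons mscale_mult_right mpower_commute)
qed

text \<open>The \<open>foldr\<close> form exposes the leftmost factor, so that the factors can be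
  stripped one at a time by induction on the list.\<close>

lemma mpoly_prod_list:
  "mpoly (\<Prod>l\<leftarrow>ls. [:- l, 1:]) P = foldr (\<lambda>l N. (P - mat l) ** N) ls (mat 1)"
proof (induction ls)
  case Nil
  then show ?case by (simp add: one_pCons mpoly_pCons mm.zero_right)
next
  case (Cons l ls)
  then show ?case by (simp only: list.map prod_list.Cons mpoly_linear_factor foldr.simps o_apply)
qed

text \<open>The exponents from 0 to the real dimension of the matrix space are one more than that
  dimension, so either two powers of \<open>P\<close> coincide or the powers are linearly
  dependent.\<close>

lemma annihilating_poly_exists:
  fixes P :: "complex^'n^'n"
  obtains p where "p \<noteq> 0" "mpoly p P = 0"
proof (cases "inj_on (mpower P) {..DIM(complex^'n^'n)}")
  case False
  \<comment> \<open>Equal powers would be identified in the image set and leave no visible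
    dependence; here the difference of the two monomials annihilates \<open>P\<close>.\<close>
  then obtain i j where "i \<noteq> j" "mpower P i = mpower P j"
    by (auto simp: inj_on_def)
  then have "mpoly (monom 1 i + smult (-1) (monom 1 j)) P = 0"
    by (simp only: mpoly_add mpoly_smult mpoly_monom) (simp add: ms.minus_left)
  moreover have "coeff (monom 1 i + smult (-1) (monom (1::complex) j)) i \<noteq> 0"
    using \<open>i \<noteq> j\<close> by simp
  ultimately show thesis
    by (metis that coeff_0)
next
  case True
  let ?I = "{..DIM(complex^'n^'n)}"
  have "dependent (mpower P ` ?I)"
    by (rule dependent_biggerset) (simp only: card_image[OF True] card_atMost lessI)
  then obtain u where u: "\<exists>v\<in>mpower P ` ?I. u v \<noteq> 0" "(\<Sum>v\<in>mpower P ` ?I. u v *\<^sub>R v) = 0"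
    by (subst (asm) dependent_finite) auto
  define p where "p = (\<Sum>i\<in>?I. monom (complex_of_real (u (mpower P i))) i)"
  from u(1) obtain i where i: "i \<in> ?I" "u (mpower P i) \<noteq> 0" by auto
  have "coeff p i = u (mpower P i)"
    using i(1) by (simp add: p_def coeff_sum if_distrib cong: if_cong)
  moreover have "mpoly p P = 0"
    using u(2) unfolding sum.reindex[OF True] by (simp add: p_def mpoly_sum mpoly_monom mscale_of_real)
  ultimately show thesis
    using i(2) that[of p] by (metis coeff_0 of_real_eq_0_iff)
qed

text \<open>A nonzero annihilating polynomial splits over the complex numbers. The list may contain
  numbers that are not eigenvalues of \<open>P\<close>; such factors are invertible and are treated
  as a separate case in \<open>exp_decay_step\<close>.\<close>

lemma annihilating_linear_factors:
  fixes P :: "complex^'n^'n"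
  obtains ls where "foldr (\<lambda>l N. (P - mat l) ** N) ls (mat 1) = 0"
proof -
  obtain p where p: "p \<noteq> 0" "mpoly p P = 0"
    by (rule annihilating_poly_exists)
  then obtain c A where "p = smult c (\<Prod>x\<in>#A. [:-x, 1:])"
    using alg_closed_imp_factorization[of p] by metis
  moreover obtain ls where "A = mset ls" by (metis ex_mset)
  moreover have "(\<Prod>x\<in>#mset ls. [:- x, 1:]) = (\<Prod>l\<leftarrow>ls. [:- l, 1:])"
    by (simp only: mset_map[symmetric] prod_mset_prod_list)
  ultimately have p_eq: "p = smult c (\<Prod>l\<leftarrow>ls. [:- l, 1:])"
    by simp
  then have "c *\<^sub>M mpoly (\<Prod>l\<leftarrow>ls. [:- l, 1:]) P = 0"
    using p(2) by (simp only: mpoly_smult)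
  then have "norm c * norm (mpoly (\<Prod>l\<leftarrow>ls. [:- l, 1:]) P) = 0"
    by (metis norm_mscale norm_zero)
  moreover have "c \<noteq> 0" using p(1) p_eq by auto
  ultimately have "mpoly (\<Prod>l\<leftarrow>ls. [:- l, 1:]) P = 0"
    by simp
  then show thesis
    using that by (simp add: mpoly_prod_list)
qed

text \<open>
  If \<open>Z' = -P Z\<close>, then decay of \<open>(P - l) Z\<close> passes to \<open>Z\<close>: by invertibility when \<open>l\<close> is no eigenvalue, and
  otherwise by integrating \<open>(e^(ls) Z)' = -e^(ls) (P - l) Z\<close>. Peeling the linear factors off an
  annihilating polynomial of \<open>P\<close> then shows that \<open>e^(-sP)\<close> decays.
\<close>

lemma exp_decay_step:
  fixes P :: "complex^'n^'n" and Z :: "real \<Rightarrow> complex^'n^'n"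
  assumes deriv: "\<And>s. (Z has_vector_derivative - (P ** Z s)) (at s)"
    and bound: "\<And>s. s \<ge> 0 \<Longrightarrow> norm ((P - mat l) ** Z s) \<le> C * exp (- d * s)"
    and eig: "eigenvalue P l \<Longrightarrow> d < Re l"
  shows "\<exists>C'. \<forall>s\<ge>0. norm (Z s) \<le> C' * exp (- d * s)"
proof (cases "eigenvalue P l")
  case False
  obtain R where R: "R ** (P - mat l) = mat 1"
    using obtain_inverse_if_not_eigenvalue[OF False] .
  obtain K where K: "\<And>(A::complex^'n^'n) (B::complex^'n^'n). norm (A ** B) \<le> norm A * norm B * K" "K \<ge> 0"
    using mm.nonneg_bounded by blast
  have "norm (Z s) \<le> norm R * C * K * exp (- d * s)" if "s \<ge> 0" for s
  proof -
    have "norm (Z s) \<le> norm R * norm ((P - mat l) ** Z s) * K"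
      using K(1)[of R "(P - mat l) ** Z s"] R by (simp add: matrix_mul_assoc)
    also have "\<dots> \<le> norm R * (C * exp (- d * s)) * K"
      using bound[OF that] K(2) by (intro mult_right_mono mult_left_mono) auto
    finally show ?thesis by (simp add: mult_ac)
  qed
  then show ?thesis by blast
next
  case True
  \<comment> \<open>The strict gap \<open>r > 0\<close> keeps the rate \<open>d\<close> from
    deteriorating: the integral of \<open>C * exp (r * x)\<close> over \<open>{0..s}\<close> is at
    most \<open>C / r * exp (r * s)\<close>, and dividing by \<open>exp (Re l * s)\<close> gives
    back \<open>exp (- d * s)\<close> without a polynomial factor.\<close>
  define r where "r = Re l - d"
  have r: "r > 0" using eig[OF True] by (simp add: r_def)
  have C: "C \<ge> 0"
    using order_trans[OF norm_ge_zero bound[of 0]] by simp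
  define g where "g s = exp (of_real s * l) *\<^sub>M Z s" for s
  have norm_g: "norm (g s) = exp (Re l * s) * norm (Z s)" for s
    by (simp add: g_def norm_mscale norm_exp_eq_Re mult.commute)
  have dg: "(g has_vector_derivative - (exp (of_real s * l) *\<^sub>M ((P - mat l) ** Z s))) (at s)" for s
  proof -
    have e: "((\<lambda>s. exp (of_real s * l)) has_vector_derivative (l * exp (of_real s * l))) (at s)"
      by (rule has_vector_derivative_real_field) (auto intro!: derivative_eq_intros)
    have "(g has_vector_derivative
        exp (of_real s * l) *\<^sub>M (- (P ** Z s)) + (l * exp (of_real s * l)) *\<^sub>M Z s) (at s)"
      unfolding g_def by (rule ms.has_vector_derivative[OF e deriv])
    then show ?thesis
      by (simp add: mm.diff_left ms.diff_right ms.minus_right mat_mult_left mult.commute)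
  qed
  have "norm (Z s) \<le> (norm (Z 0) + C / r) * exp (- d * s)" if "s \<ge> 0" for s
  proof (cases "s = 0")
    case True
    then show ?thesis using r C by simp
  next
    case False
    \<comment> \<open>The mean value inequality against a majorant: the derivative of
      \<open>g\<close> is dominated by that of \<open>C / r * exp (r * s)\<close>.\<close>
    have "norm (g s - g 0) \<le> C / r * exp (r * s) - C / r * exp (r * 0)"
    proof (rule differentiable_bound_general)
      show "0 < s" using that False by simp
      show "continuous_on {0..s} g"
        using dg has_vector_derivative_continuous continuous_at_imp_continuous_on by blast
      show "continuous_on {0..s} (\<lambda>s. C / r * exp (r * s))"
        by (intro continuous_intros)
      show "(g has_vector_derivative - (exp (of_real x * l) *\<^sub>M ((P - mat l) ** Z x))) (at x)" for x
        by (rule dg)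
      show "((\<lambda>s. C / r * exp (r * s)) has_vector_derivative C * exp (r * x)) (at x)" for x
        using r by (auto intro!: derivative_eq_intros simp flip: has_real_derivative_iff_has_vector_derivative)
      fix x assume "0 < x" "x < s"
      have "norm (- (exp (of_real x * l) *\<^sub>M ((P - mat l) ** Z x))) \<le> exp (Re l * x) * (C * exp (- d * x))"
        using bound[of x] \<open>0 < x\<close> by (simp add: norm_mscale norm_exp_eq_Re mult.commute)
      also have "\<dots> = C * exp (r * x)"
        by (simp add: r_def left_diff_distrib exp_diff exp_minus field_simps)
      finally show "norm (- (exp (of_real x * l) *\<^sub>M ((P - mat l) ** Z x))) \<le> C * exp (r * x)" .
    qed
    also have "\<dots> \<le> C / r * exp (r * s)" using r C by simp
    finally have "norm (g s) \<le> norm (g 0) + C / r * exp (r * s)"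
      using norm_triangle_sub[of "g s" "g 0"] by linarith
    then have "exp (Re l * s) * norm (Z s) \<le> norm (Z 0) + C / r * exp (r * s)"
      by (simp add: norm_g)
    also have "\<dots> \<le> (norm (Z 0) + C / r) * exp (r * s)"
      using r that by (simp add: distrib_right mult_left_le mult_le_cancel_left1)
    finally have "norm (Z s) \<le> (norm (Z 0) + C / r) * (exp (r * s) / exp (Re l * s))"
      by (simp add: field_simps)
    also have "exp (r * s) / exp (Re l * s) = exp (- d * s)"
      by (simp add: r_def left_diff_distrib flip: exp_diff)
    finally show ?thesis .
  qed
  then show ?thesis by blast
qed

lemma exp_decay_factors:
  fixes P :: "complex^'n^'n" and Z :: "real \<Rightarrow> complex^'n^'n"
  assumes "\<And>s. (Z has_vector_derivative - (P ** Z s)) (at s)"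
    and "\<And>s. s \<ge> 0 \<Longrightarrow> norm (foldr (\<lambda>l N. (P - mat l) ** N) ls (mat 1) ** Z s) \<le> C * exp (- d * s)"
    and "\<And>l. l \<in> set ls \<Longrightarrow> eigenvalue P l \<Longrightarrow> d < Re l"
  shows "\<exists>C'. \<forall>s\<ge>0. norm (Z s) \<le> C' * exp (- d * s)"
  using assms
proof (induction ls arbitrary: C)
  case Nil
  then show ?case by auto
next
  case (Cons l ls)
  let ?F = "foldr (\<lambda>l N. (P - mat l) ** N) ls (mat 1)"
  \<comment> \<open>Because the product of the remaining factors commutes with \<open>P\<close>, its
    product with \<open>Z\<close> solves the same differential equation as \<open>Z\<close>, and the
    one-factor step applies to it.\<close>
  have comm: "foldr (\<lambda>l N. (P - mat l) ** N) xs (mat 1) ** P = P ** foldr (\<lambda>l N. (P - mat l) ** N) xs (mat 1)" for xs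
  proof (induction xs)
    case (Cons x xs)
    have "(P - mat x) ** foldr (\<lambda>l N. (P - mat l) ** N) xs (mat 1) ** P
        = ((P - mat x) ** P) ** foldr (\<lambda>l N. (P - mat l) ** N) xs (mat 1)"
      by (metis Cons.IH matrix_mul_assoc)
    also have "(P - mat x) ** P = P ** (P - mat x)"
      by (simp add: mm.diff_left mm.diff_right mat_mult_left mat_mult_right)
    finally show ?case by (simp add: matrix_mul_assoc)
  qed simp
  have "\<exists>C'. \<forall>s\<ge>0. norm (?F ** Z s) \<le> C' * exp (- d * s)"
  proof (rule exp_decay_step)
    show "((\<lambda>s. ?F ** Z s) has_vector_derivative - (P ** (?F ** Z s))) (at s)" for s
      using bounded_linear.has_vector_derivative[OF mm.bounded_linear_right Cons.prems(1)[of s], of ?F]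
      by (simp add: mm.minus_right matrix_mul_assoc comm)
    show "norm ((P - mat l) ** (?F ** Z s)) \<le> C * exp (- d * s)" if "s \<ge> 0" for s
      using Cons.prems(2)[OF that] by (simp add: matrix_mul_assoc)
    show "d < Re l" if "eigenvalue P l"
      using Cons.prems(3)[of l] that by simp
  qed
  then obtain C' where "\<And>s. s \<ge> 0 \<Longrightarrow> norm (?F ** Z s) \<le> C' * exp (- d * s)" by blast
  then show ?case
    using Cons.IH[of C'] Cons.prems(1,3) by auto
qed

lemma positive_stable_exp_decay:
  fixes P :: "complex^'n^'n"
  assumes "positive_stable P"
  obtains C d where "C > 0" "d > 0" "\<And>s. s \<ge> 0 \<Longrightarrow> norm (mexp (- (s *\<^sub>R P))) \<le> C * exp (- d * s)"
proof -
  obtain ls where ls: "foldr (\<lambda>l N. (P - mat l) ** N) ls (mat 1) = 0"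
    by (rule annihilating_linear_factors)
  \<comment> \<open>One rate must serve for the whole list: it lies below the finitely many positive
    real parts of the eigenvalues that occur in it.\<close>
  have "\<exists>d>0. \<forall>l\<in>set xs. eigenvalue P l \<longrightarrow> d < Re l" for xs
  proof (induction xs)
    case Nil
    show ?case by (rule exI[of _ 1]) simp
  next
    case (Cons l xs)
    then obtain d where d: "d > 0" "\<forall>l\<in>set xs. eigenvalue P l \<longrightarrow> d < Re l" by blast
    show ?case
    proof (cases "eigenvalue P l")
      case True
      then have "Re l > 0" using assms by (simp add: positive_stable_def)
      with d show ?thesis
        by (intro exI[of _ "min d (Re l / 2)"]) force
    qed (use d in auto)
  qed
  then obtain d where d: "d > 0" "\<And>l. l \<in> set ls \<Longrightarrow> eigenvalue P l \<Longrightarrow> d < Re l" by blast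
  have "((\<lambda>s. mexp (- (s *\<^sub>R P))) has_vector_derivative - (P ** mexp (- (s *\<^sub>R P)))) (at s)" for s
    using mexp_scaleR_has_vector_derivative[of "- P" s UNIV] by (simp add: mm.minus_left)
  \<comment> \<open>The full product of factors vanishes, so the decay hypothesis holds with
    \<open>C = 0\<close>.\<close>
  then have "\<exists>C'. \<forall>s\<ge>0. norm (mexp (- (s *\<^sub>R P))) \<le> C' * exp (- d * s)"
    by (rule exp_decay_factors[where ls = ls and C = 0]) (use ls d in \<open>auto simp: mm.zero_left\<close>)
  then obtain C where C: "\<And>s. s \<ge> 0 \<Longrightarrow> norm (mexp (- (s *\<^sub>R P))) \<le> C * exp (- d * s)" by blast
  show thesis
  proof (rule that[of "\<bar>C\<bar> + 1" d])
    fix s :: real assume "s \<ge> 0"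
    then show "norm (mexp (- (s *\<^sub>R P))) \<le> (\<bar>C\<bar> + 1) * exp (- d * s)"
      using C[of s] by (smt (verit) exp_gt_zero mult_right_mono)
  qed (use d in auto)
qed

section \<open>Real powers of matrices\<close>

lemma mscale_mat [simp]: "c *\<^sub>M mat d = mat (c * d)"
  by (simp add: mat_def mscale_def vec_eq_iff)

lemma mpower_mat: "mpower (mat c) n = mat (c ^ n)"
  by (induction n) (simp_all add: mat_mult_right)

lemma mat_scaleR: "mat (r *\<^sub>R c) = r *\<^sub>R mat c"
  by (simp add: mat_def vec_eq_iff)

lemma mexp_mat: "mexp (mat c) = (mat (exp c) :: complex^'n^'n)"
proof -
  have "(\<lambda>n. (c ^ n /\<^sub>R fact n) *\<^sub>M mat 1) sums (exp c *\<^sub>M (mat 1 :: complex^'n^'n))"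
    by (rule bounded_linear.sums[OF ms.bounded_linear_left exp_converges])
  moreover have "mat (c ^ n /\<^sub>R fact n) = (1 / fact n) *\<^sub>R (mpower (mat c) n :: complex^'n^'n)" for n
    by (simp only: mat_scaleR mpower_mat inverse_eq_divide)
  ultimately have "(\<lambda>n. (1 / fact n) *\<^sub>R mpower (mat c) n) sums (mat (exp c) :: complex^'n^'n)"
    by (simp only: mscale_mat mult_1_right)
  then show ?thesis
    using sums_mexp sums_unique2 by blast
qed

lemma mpowr_add_commute:
  assumes "A ** B = B ** A"
  shows "mpowr t (A + B) = mpowr t A ** mpowr t B"
  unfolding mpowr_def scaleR_add_right
  by (rule mexp_add_commute) (simp add: mm.scaleR_left mm.scaleR_right assms)

lemma mpowr_commute:
  assumes "A ** B = B ** A"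
  shows "mpowr t A ** B = B ** mpowr t A"
  unfolding mpowr_def
  by (rule mexp_commute) (simp add: mm.scaleR_left mm.scaleR_right assms)

lemma mpowr_mpowr_commute:
  assumes "A ** B = B ** A"
  shows "mpowr s A ** mpowr t B = mpowr t B ** mpowr s A"
  by (metis assms mpowr_commute)

lemma mpowr_minus_right: "mpowr t A ** mpowr t (- A) = mat 1"
proof -
  have "mpowr t (A + - A) = mpowr t A ** mpowr t (- A)"
    by (rule mpowr_add_commute) (simp add: mm.minus_left mm.minus_right)
  then show ?thesis by (simp add: mpowr_def)
qed

lemma mpowr_mat:
  assumes "t > 0"
  shows "mpowr t (mat (complex_of_real r)) = (t powr r) *\<^sub>R (mat 1 :: complex^'n^'n)"
proof -
  have "ln t *\<^sub>R mat (complex_of_real r) = (mat (complex_of_real (r * ln t)) :: complex^'n^'n)"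
    unfolding mat_scaleR[symmetric] by (rule arg_cong[where f = mat]) (simp add: scaleR_conv_of_real)
  then have "mpowr t (mat (complex_of_real r)) = (mat (complex_of_real (t powr r)) :: complex^'n^'n)"
    using assms by (simp add: mpowr_def mexp_mat exp_of_real powr_def del: of_real_mult)
  also have "\<dots> = mat ((t powr r) *\<^sub>R 1)"
    by (simp add: scaleR_conv_of_real)
  finally show ?thesis
    by (simp only: mat_scaleR)
qed

text \<open>Scalar matrices commute with everything and their powers are scalar. Integer shifts of a
  parameter thus become factors \<open>t ^ n\<close> under the integrals.\<close>

lemma mpowr_add_mat:
  assumes "t > 0"
  shows "mpowr t (A + mat (complex_of_real r)) = (t powr r) *\<^sub>R mpowr t A"
  by (subst mpowr_add_commute) (simp_all add: mat_mult_left mat_mult_right mpowr_mat[OF assms] mm.scaleR_right)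

lemma mpowr_diff_mat_1:
  assumes "t > 0"
  shows "mpowr t (A - mat 1) = (1 / t) *\<^sub>R mpowr t A"
proof -
  have "A - mat 1 = A + mat (complex_of_real (- 1))"
    by (simp add: mat_def vec_eq_iff)
  then show ?thesis
    using assms by (simp only: mpowr_add_mat) (simp add: powr_minus_divide)
qed

lemma mpowr_has_vector_derivative:
  assumes "t > 0"
  shows "((\<lambda>t. mpowr t A) has_vector_derivative (1 / t) *\<^sub>R (A ** mpowr t A)) (at t)"
proof -
  have "((\<lambda>s. mexp (s *\<^sub>R A)) \<circ> ln has_vector_derivative (1 / t) *\<^sub>R (A ** mexp (ln t *\<^sub>R A))) (at t)"
    by (rule vector_diff_chain_at[OF _ mexp_scaleR_has_vector_derivative])
      (use assms in \<open>auto intro!: derivative_eq_intros simp flip: has_real_derivative_iff_has_vector_derivative\<close>)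
  then show ?thesis
    by (simp add: mpowr_def o_def)
qed

lemma mpowr_one_minus_has_vector_derivative:
  assumes "t < 1"
  shows "((\<lambda>t. mpowr (1 - t) A) has_vector_derivative - ((1 / (1 - t)) *\<^sub>R (A ** mpowr (1 - t) A))) (at t)"
proof -
  have "((\<lambda>t. mpowr t A) \<circ> (\<lambda>t. 1 - t) has_vector_derivative
      (-1) *\<^sub>R ((1 / (1 - t)) *\<^sub>R (A ** mpowr (1 - t) A))) (at t)"
    by (rule vector_diff_chain_at[OF _ mpowr_has_vector_derivative])
      (use assms in \<open>auto intro!: derivative_eq_intros simp flip: has_real_derivative_iff_has_vector_derivative\<close>)
  then show ?thesis
    by (simp add: o_def)
qed

lemma continuous_on_mpowr:
  assumes "\<And>t. t \<in> S \<Longrightarrow> t > 0"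
  shows "continuous_on S (\<lambda>t. mpowr t A)"
  using assms mpowr_has_vector_derivative has_vector_derivative_continuous
  by (blast intro: continuous_at_imp_continuous_on)

lemma continuous_on_mpowr_one_minus:
  assumes "\<And>t. t \<in> S \<Longrightarrow> t < 1"
  shows "continuous_on S (\<lambda>t. mpowr (1 - t) A)"
  using assms mpowr_one_minus_has_vector_derivative has_vector_derivative_continuous
  by (blast intro: continuous_at_imp_continuous_on)

text \<open>For an arbitrary matrix the power may blow up at 0, but at most polynomially. This
  controls the factor \<open>mpowr (1 - u) (- A)\<close> of the kernel.\<close>

lemma mpowr_bound:
  obtains C L where "C \<ge> 0" "L \<ge> 0"
    "\<And>t. 0 < t \<Longrightarrow> t \<le> 1 \<Longrightarrow> norm (mpowr t A) \<le> C * t powr (- L)"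
proof -
  obtain C L where "C \<ge> 0" "L \<ge> 0" and *: "\<And>s. s \<ge> 0 \<Longrightarrow> norm (mexp (s *\<^sub>R (- A))) \<le> C * exp (L * s)"
    by (rule mexp_exponential_bound[of "- A"], rule that)
  moreover have "norm (mpowr t A) \<le> C * t powr (- L)" if "0 < t" "t \<le> 1" for t
    using *[of "- ln t"] that by (simp add: mpowr_def powr_def)
  ultimately show ?thesis using that by blast
qed

text \<open>The decay bound at \<open>s = - ln t\<close>. The positive exponent \<open>d\<close> is
  what makes \<open>mpowr t (A - mat 1)\<close>, of order \<open>t powr (d - 1)\<close>, integrable
  at 0.\<close>

lemma positive_stable_mpowr_bound:
  assumes "positive_stable A"
  obtains C d where "C > 0" "d > 0"
    "\<And>t. 0 < t \<Longrightarrow> t \<le> 1 \<Longrightarrow> norm (mpowr t A) \<le> C * t powr d"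
proof -
  obtain C d where "C > 0" "d > 0" and *: "\<And>s. s \<ge> 0 \<Longrightarrow> norm (mexp (- (s *\<^sub>R A))) \<le> C * exp (- d * s)"
    by (rule positive_stable_exp_decay[OF assms], rule that)
  moreover have "norm (mpowr t A) \<le> C * t powr d" if "0 < t" "t \<le> 1" for t
    using *[of "- ln t"] that by (simp add: mpowr_def powr_def)
  ultimately show ?thesis using that by blast
qed

section \<open>Continuous functions on the unit interval with vanishing moments\<close>

lemma vanishing_moments_real:
  fixes g :: "real \<Rightarrow> real"
  assumes cont: "continuous_on {0..1} g"
    and mom: "\<And>n. integral {0..1} (\<lambda>x. x ^ n * g x) = 0"
    and x: "x \<in> {0..1}"
  shows "g x = 0"
proof -
  \<comment> \<open>Orthogonality to the powers gives orthogonality to all polynomials.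
    Approximating \<open>g\<close> uniformly by a polynomial then makes the integral of its square
    arbitrarily small.\<close>
  have poly: "integral {0..1} (\<lambda>x. p x * g x) = 0" if rp: "real_polynomial_function p" for p
  proof -
    obtain a n where p: "p = (\<lambda>x. \<Sum>i\<le>n. a i * x ^ i)"
      using rp unfolding real_polynomial_function_iff_sum by blast
    have int: "(\<lambda>x. x ^ i * g x) integrable_on {0..1}" for i
      by (intro integrable_continuous_real continuous_intros cont)
    have "integral {0..1} (\<lambda>x. p x * g x) = integral {0..1} (\<lambda>x. \<Sum>i\<le>n. a i *\<^sub>R (x ^ i * g x))"
      by (simp add: p sum_distrib_right mult.assoc)
    also have "\<dots> = (\<Sum>i\<le>n. integral {0..1} (\<lambda>x. a i *\<^sub>R (x ^ i * g x)))"
      by (rule integral_sum) (intro integrable_cmul int finite_atMost)+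
    also have "\<dots> = 0"
      by (simp only: integral_cmul mom) simp
    finally show ?thesis .
  qed
  have "\<exists>M. \<forall>x\<in>{0..1}. \<bar>g x\<bar> \<le> M"
    using compact_imp_bounded[OF compact_continuous_image[OF cont compact_Icc]]
    by (auto simp: bounded_iff)
  then obtain M where M: "\<And>x. x \<in> {0..1} \<Longrightarrow> \<bar>g x\<bar> \<le> M" by blast
  have M0: "M \<ge> 0" using M[of 0] by simp
  have sq: "(\<lambda>x. g x * g x) integrable_on {0..1}"
    by (intro integrable_continuous_real continuous_intros cont)
  have "integral {0..1} (\<lambda>x. g x * g x) \<le> e" if "e > 0" for e
  proof -
    \<comment> \<open>With this accuracy the difference of the integrands is at most
      \<open>d * (M + 1) = e\<close>; using \<open>M + 1\<close> avoids a zero denominator when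
      \<open>M = 0\<close>.\<close>
    define d where "d = e / (M + 1)"
    have d: "d > 0" using that M0 by (simp add: d_def)
    obtain p where p: "real_polynomial_function p" "\<And>x. x \<in> {0..1} \<Longrightarrow> \<bar>g x - p x\<bar> < d"
      using Stone_Weierstrass_real_polynomial_function[OF compact_Icc cont d] by blast
    have contp: "continuous_on {0..1} p"
      using p(1) by (simp add: continuous_on_polymonial_function real_polynomial_function_eq)
    have intp: "(\<lambda>x. p x * g x) integrable_on {0..1}"
      by (intro integrable_continuous_real continuous_intros cont contp)
    have "integral {0..1} (\<lambda>x. g x * g x) = integral {0..1} (\<lambda>x. g x * g x - p x * g x)"
      by (simp add: integral_diff[OF sq intp] poly[OF p(1)])
    also have "\<dots> \<le> integral {0..1} (\<lambda>x::real. e)"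
    proof (rule integral_le)
      fix x :: real assume x: "x \<in> {0..1}"
      have "g x * g x - p x * g x \<le> \<bar>g x - p x\<bar> * \<bar>g x\<bar>"
        by (metis abs_ge_self abs_mult left_diff_distrib)
      also have "\<dots> \<le> d * (M + 1)"
        using p(2)[OF x] M[OF x] by (intro mult_mono) auto
      finally show "g x * g x - p x * g x \<le> e"
        using M0 by (simp add: d_def)
    qed (auto intro: integrable_diff sq intp)
    finally show ?thesis by simp
  qed
  then have "integral {0..1} (\<lambda>x. g x * g x) \<le> 0"
    by (rule field_le_epsilon) simp
  moreover have "integral {0..1} (\<lambda>x. g x * g x) \<ge> 0"
    by (rule integral_nonneg[OF sq]) simp
  ultimately have "((\<lambda>x. g x * g x) has_integral 0) (cbox 0 1)"
    using sq by (simp add: has_integral_iff)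
  then have "g x * g x = 0"
    by (rule has_integral_0_cbox_imp_0[rotated 2]) (use x in \<open>auto intro!: continuous_intros cont\<close>)
  then show ?thesis by simp
qed

lemma vanishing_moments:
  fixes f :: "real \<Rightarrow> 'a::euclidean_space"
  assumes cont: "continuous_on {0..1} f"
    and mom: "\<And>n. integral {0..1} (\<lambda>x. x ^ n *\<^sub>R f x) = 0"
    and x: "x \<in> {0..1}"
  shows "f x = 0"
proof (rule euclidean_eqI)
  fix b :: 'a assume "b \<in> Basis"
  have "f x \<bullet> b = 0"
  proof (rule vanishing_moments_real[OF _ _ x])
    show "continuous_on {0..1} (\<lambda>x. f x \<bullet> b)"
      by (intro continuous_intros cont)
    fix n
    have "(\<lambda>x. x ^ n *\<^sub>R f x) integrable_on {0..1}"
      by (intro integrable_continuous_real continuous_intros cont)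
    from integral_component_eq[OF this, of b] mom[of n]
    show "integral {0..1} (\<lambda>x. x ^ n * (f x \<bullet> b)) = 0"
      by simp
  qed
  then show "f x \<bullet> b = 0 \<bullet> b" by simp
qed

section \<open>Matrix beta kernels\<close>

lemma integrable_on_Ioo_dominated:
  fixes f :: "real \<Rightarrow> 'b::euclidean_space"
  assumes "f \<in> borel_measurable (lebesgue_on {a<..<b})" "g integrable_on {a<..<b}"
    and "\<And>x. a < x \<Longrightarrow> x < b \<Longrightarrow> norm (f x) \<le> g x"
  shows "f integrable_on {a<..<b}"
  by (rule measurable_bounded_by_integrable_imp_integrable[OF assms(1,2)]) (use assms(3) in auto)

lemma integrable_powr_Ioo:
  "e > 0 \<Longrightarrow> (\<lambda>x::real. c * x powr (e - 1)) integrable_on {0<..<1}"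
  unfolding integrable_on_open_interval_real
  by (intro integrable_on_mult_right integrable_on_powr_from_0) auto

text \<open>
  Here \<open>E\<close> stands for \<open>D - I\<close>, the kernel of \<open>J\<^sub>n\<close> is \<open>(u^n/u) core M u\<close>, and \<open>J\<^sub>n(M)\<close> is \<open>moment n M\<close>.
\<close>

locale beta_kernel =
  fixes A E :: "complex^'n^'n" and e c :: real
  assumes e_pos: "e > 0" and c_nonneg: "c \<ge> 0"
    and kernel_bound: "\<And>u M. 0 < u \<Longrightarrow> u < 1 \<Longrightarrow>
      norm (mpowr u A ** mpowr (1 - u) (- A) ** M ** mpowr (1 - u) E) \<le> c * norm M * (u powr e * (1 - u))"
    and shift_invertible: "\<And>n. invertible (E + mat (of_nat (Suc n)))"
begin

definition core :: "complex^'n^'n \<Rightarrow> real \<Rightarrow> complex^'n^'n" where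
  "core M u = (if 0 < u \<and> u < 1 then mpowr u A ** mpowr (1 - u) (- A) ** M ** mpowr (1 - u) E else 0)"

text \<open>The quotient \<open>u ^ n / u\<close> stands for the power with exponent
  \<open>n - 1\<close>. For \<open>n = 0\<close> it is the singular weight \<open>1 / u\<close>,
  which is integrable against \<open>core M\<close> by the factor \<open>u powr e\<close> in the
  kernel bound.\<close>

definition moment :: "nat \<Rightarrow> complex^'n^'n \<Rightarrow> complex^'n^'n" where
  "moment n M = integral {0<..<1} (\<lambda>u. (u ^ n / u) *\<^sub>R core M u)"

lemma core_bound: "0 \<le> u \<Longrightarrow> u \<le> 1 \<Longrightarrow> norm (core M u) \<le> c * norm M * (u powr e * (1 - u))"
  using kernel_bound[of u M] c_nonneg by (auto simp: core_def)

lemma core_add: "core (M + N) u = core M u + core N u"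
  by (simp add: core_def mm.add_left mm.add_right)

lemma core_scaleR: "core (r *\<^sub>R M) u = r *\<^sub>R core M u"
  by (simp add: core_def mm.scaleR_left mm.scaleR_right)

text \<open>The matrix \<open>M\<close> separates the powers of \<open>A\<close> from the power of
  \<open>E\<close>. Hence \<open>A\<close> can be moved to the far left and \<open>E\<close> to the
  far right without any commutation between \<open>A\<close>, \<open>M\<close> and
  \<open>E\<close>.\<close>

lemma core_has_vector_derivative:
  assumes "0 < u" "u < 1"
  shows "(core M has_vector_derivative
    ((1 / u) *\<^sub>R (A ** core M u) + (1 / (1 - u)) *\<^sub>R (A ** core M u) - (1 / (1 - u)) *\<^sub>R (core M u ** E))) (at u)"
proof -
  let ?a = "mpowr u A" and ?b = "mpowr (1 - u) (- A)" and ?d = "mpowr (1 - u) E"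
  have ab: "mpowr u A ** A = A ** mpowr u A" by (rule mpowr_commute) simp
  have d: "?d ** E = E ** ?d" by (rule mpowr_commute) simp
  have "((\<lambda>u. mpowr u A ** mpowr (1 - u) (- A) ** M ** mpowr (1 - u) E) has_vector_derivative
     (?a ** ?b ** M) ** (- ((1 / (1 - u)) *\<^sub>R (E ** ?d))) +
     ((?a ** (- ((1 / (1 - u)) *\<^sub>R (- A ** ?b))) + ((1 / u) *\<^sub>R (A ** ?a)) ** ?b) ** M) ** ?d) (at u)"
    by (intro mm.has_vector_derivative mpowr_one_minus_has_vector_derivative mpowr_has_vector_derivative
        bounded_linear.has_vector_derivative[OF mm.bounded_linear_left] assms)
  also have "(?a ** ?b ** M) ** (- ((1 / (1 - u)) *\<^sub>R (E ** ?d))) = - ((1 / (1 - u)) *\<^sub>R (core M u ** E))"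
    using assms by (simp add: core_def mm.minus_right mm.scaleR_right d flip: matrix_mul_assoc)
  also have "((?a ** (- ((1 / (1 - u)) *\<^sub>R (- A ** ?b))) + ((1 / u) *\<^sub>R (A ** ?a)) ** ?b) ** M) ** ?d
     = (1 / (1 - u)) *\<^sub>R (?a ** A ** ?b ** M ** ?d) + (1 / u) *\<^sub>R (A ** ?a ** ?b ** M ** ?d)"
    by (simp add: mm.add_left mm.minus_left mm.minus_right mm.scaleR_left mm.scaleR_right matrix_mul_assoc)
  also have "\<dots> = (1 / (1 - u)) *\<^sub>R (A ** core M u) + (1 / u) *\<^sub>R (A ** core M u)"
    using assms by (simp add: core_def matrix_mul_assoc ab)
  finally have "((\<lambda>u. mpowr u A ** mpowr (1 - u) (- A) ** M ** mpowr (1 - u) E) has_vector_derivative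
    ((1 / u) *\<^sub>R (A ** core M u) + (1 / (1 - u)) *\<^sub>R (A ** core M u) - (1 / (1 - u)) *\<^sub>R (core M u ** E))) (at u)"
    by (simp add: algebra_simps)
  then show ?thesis
    by (rule has_vector_derivative_transform_within_open[where S = "{0<..<1}"])
      (use assms in \<open>auto simp: core_def\<close>)
qed

text \<open>In the interior this follows from differentiability. At the end points the kernel bound
  squeezes \<open>core M\<close> to its value 0: \<open>u powr e\<close> does so at 0 and
  \<open>1 - u\<close> at 1.\<close>

lemma continuous_on_core: "continuous_on {0..1} (core M)"
proof -
  have bound_cont: "continuous_on {0..1} (\<lambda>u. c * norm M * (u powr e * (1 - u)))"
    by (intro continuous_intros continuous_on_powr') (use e_pos in auto)
  have "(core M \<longlongrightarrow> core M x) (at x within {0..1})" if x: "x \<in> {0..1}" for x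
  proof (cases "x = 0 \<or> x = 1")
    case True
    have "((\<lambda>u. c * norm M * (u powr e * (1 - u))) \<longlongrightarrow> c * norm M * (x powr e * (1 - x))) (at x within {0..1})"
      using bound_cont x by (auto simp: continuous_on_def)
    then have "((\<lambda>u. c * norm M * (u powr e * (1 - u))) \<longlongrightarrow> 0) (at x within {0..1})"
      using True by auto
    moreover have "eventually (\<lambda>u. norm (core M u) \<le> c * norm M * (u powr e * (1 - u))) (at x within {0..1})"
      by (auto simp: eventually_at_filter core_bound)
    ultimately have "(core M \<longlongrightarrow> 0) (at x within {0..1})"
      by (rule Lim_null_comparison[rotated])
    then show ?thesis
      using True by (auto simp: core_def)
  next
    case False
    then have "isCont (core M) x"
      using x by (intro has_vector_derivative_continuous[OF core_has_vector_derivative]) auto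
    then show ?thesis
      by (simp add: continuous_at_imp_continuous_at_within flip: continuous_within)
  qed
  then show ?thesis
    by (simp add: continuous_on_def)
qed

lemma integrand_measurable:
  "(\<lambda>u. (u ^ n / u) *\<^sub>R core M u) \<in> borel_measurable (lebesgue_on {0<..<1})"
  by (intro continuous_imp_measurable_on_sets_lebesgue continuous_intros
      continuous_on_subset[OF continuous_on_core]) auto

text \<open>The majorant does not depend on \<open>n\<close>, so it serves for a single moment and
  for a whole series of them.\<close>

lemma integrand_bound:
  assumes "0 < u" "u < 1"
  shows "norm ((u ^ n / u) *\<^sub>R core M u) \<le> c * norm M * u powr (e - 1)"
proof -
  have "norm ((u ^ n / u) *\<^sub>R core M u) = u ^ n * (norm (core M u) / u)"
    using assms by simp
  also have "\<dots> \<le> 1 * (c * norm M * (u powr e * 1) / u)"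
  proof (intro mult_mono divide_right_mono)
    show "u ^ n \<le> 1" using assms by (simp add: power_le_one)
    have "norm (core M u) \<le> c * norm M * (u powr e * (1 - u))"
      using assms by (intro core_bound) auto
    also have "\<dots> \<le> c * norm M * (u powr e * 1)"
      using assms c_nonneg by (intro mult_left_mono) auto
    finally show "norm (core M u) \<le> c * norm M * (u powr e * 1)" .
  qed (use assms in auto)
  also have "\<dots> = c * norm M * u powr (e - 1)"
    using assms by (simp add: powr_diff)
  finally show ?thesis .
qed

lemma integrand_integrable: "(\<lambda>u. (u ^ n / u) *\<^sub>R core M u) integrable_on {0<..<1}"
  by (rule integrable_on_Ioo_dominated[OF integrand_measurable integrable_powr_Ioo[OF e_pos] integrand_bound])

lemma has_integral_moment: "((\<lambda>u. (u ^ n / u) *\<^sub>R core M u) has_integral moment n M) {0<..<1}"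
  unfolding moment_def using integrand_integrable by (rule integrable_integral)

lemma linear_moment: "linear (moment n)"
proof (rule linearI)
  show "moment n (M + N) = moment n M + moment n N" for M N
    by (simp add: moment_def core_add scaleR_add_right integral_add integrand_integrable)
  show "moment n (r *\<^sub>R M) = r *\<^sub>R moment n M" for r M
  proof -
    have "(\<lambda>u. (u ^ n / u) *\<^sub>R core (r *\<^sub>R M) u) = (\<lambda>u. r *\<^sub>R ((u ^ n / u) *\<^sub>R core M u))"
      by (simp add: core_scaleR mult.commute fun_eq_iff)
    then show ?thesis by (simp only: moment_def integral_cmul)
  qed
qed

text \<open>Integration by parts: the boundary term \<open>u\<^sup>n (1 - u) core M u\<close> vanishes at both ends.\<close>

lemma moment_Suc: "moment (Suc n) M ** (E + mat (of_nat (Suc n))) = (A + mat (of_nat n)) ** moment n M"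
proof -
  let ?d = "\<lambda>u. (A + mat (of_nat n)) ** ((u ^ n / u) *\<^sub>R core M u)
    - ((u ^ Suc n / u) *\<^sub>R core M u) ** (E + mat (of_nat (Suc n)))"
  have "(?d has_integral (1 ^ n * (1 - 1)) *\<^sub>R core M 1 - (0 ^ n * (1 - 0)) *\<^sub>R core M 0) {0..1}"
  proof (rule fundamental_theorem_of_calculus_interior)
    show "continuous_on {0..1} (\<lambda>u. (u ^ n * (1 - u)) *\<^sub>R core M u)"
      by (intro continuous_intros continuous_on_core)
    fix u :: real assume u: "u \<in> {0<..<1}"
    \<comment> \<open>Writing \<open>u ^ n / u\<close> instead of a power with exponent
      \<open>n - 1\<close> makes the formula correct for \<open>n = 0\<close> as well.\<close>
    have "((\<lambda>u. u ^ n) has_real_derivative of_nat n * (u ^ n / u)) (at u)"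
      using DERIV_pow[of n u] u by (cases n) auto
    moreover have "((\<lambda>u. 1 - u) has_real_derivative - 1) (at u)"
      by (auto intro!: derivative_eq_intros)
    ultimately have "((\<lambda>u. u ^ n * (1 - u)) has_real_derivative u ^ n * - 1 + of_nat n * (u ^ n / u) * (1 - u)) (at u)"
      by (rule DERIV_mult')
    then have pow: "((\<lambda>u. u ^ n * (1 - u)) has_real_derivative (of_nat n * (u ^ n / u)) * (1 - u) - u ^ n) (at u)"
      by simp
    have "((\<lambda>u. (u ^ n * (1 - u)) *\<^sub>R core M u) has_vector_derivative
      ((u ^ n * (1 - u)) *\<^sub>R ((1 / u) *\<^sub>R (A ** core M u) + (1 / (1 - u)) *\<^sub>R (A ** core M u) - (1 / (1 - u)) *\<^sub>R (core M u ** E))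
       + ((of_nat n * (u ^ n / u)) * (1 - u) - u ^ n) *\<^sub>R core M u)) (at u)"
      using u by (intro has_vector_derivative_scaleR pow core_has_vector_derivative) auto
    also have "(u ^ n * (1 - u)) *\<^sub>R ((1 / u) *\<^sub>R (A ** core M u) + (1 / (1 - u)) *\<^sub>R (A ** core M u) - (1 / (1 - u)) *\<^sub>R (core M u ** E))
       = ((u ^ n * (1 - u)) * (1 / u) + (u ^ n * (1 - u)) * (1 / (1 - u))) *\<^sub>R (A ** core M u)
         - ((u ^ n * (1 - u)) * (1 / (1 - u))) *\<^sub>R (core M u ** E)"
      by (simp only: scaleR_add_right scaleR_diff_right scaleR_add_left scaleR_scaleR)
    also have "(u ^ n * (1 - u)) * (1 / (1 - u)) = u ^ n"
      using u by simp
    also have "(u ^ n * (1 - u)) * (1 / u) + u ^ n = u ^ n / u"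
      using u by (simp add: field_simps)
    also have "(u ^ n / u) *\<^sub>R (A ** core M u) - u ^ n *\<^sub>R (core M u ** E)
       + ((of_nat n * (u ^ n / u)) * (1 - u) - u ^ n) *\<^sub>R core M u = ?d u"
    proof -
      have 1: "of_nat k *\<^sub>M X = of_nat k *\<^sub>R X" for k and X :: "complex^'n^'n"
        by (metis mscale_of_real of_real_of_nat_eq)
      have 2: "(of_nat n * (u ^ n / u)) * (1 - u) - u ^ n = (u ^ n / u) * of_nat n - u ^ n * of_nat (Suc n)"
        using u by (simp add: field_simps)
      have 3: "u ^ Suc n / u = u ^ n" using u by simp
      show ?thesis
        unfolding 2 3 by (simp only: mm.add_left mm.add_right mm.scaleR_left mm.scaleR_right mat_mult_left mat_mult_right 1
            scaleR_add_right scaleR_diff_left scaleR_scaleR) (simp add: algebra_simps)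
    qed
    finally show "((\<lambda>u. (u ^ n * (1 - u)) *\<^sub>R core M u) has_vector_derivative ?d u) (at u)" .
  qed simp
  then have "(?d has_integral 0) {0<..<1}"
    by (simp add: core_def has_integral_Icc_iff_Ioo)
  moreover have "(?d has_integral ((A + mat (of_nat n)) ** moment n M - moment (Suc n) M ** (E + mat (of_nat (Suc n))))) {0<..<1}"
    by (intro has_integral_diff
        has_integral_linear[OF has_integral_moment mm.bounded_linear_right, unfolded o_def]
        has_integral_linear[OF has_integral_moment mm.bounded_linear_left, unfolded o_def])
  ultimately have "(A + mat (of_nat n)) ** moment n M - moment (Suc n) M ** (E + mat (of_nat (Suc n))) = 0"
    by (rule has_integral_unique[symmetric])
  then show ?thesis by simp
qed

text \<open>In \<open>moment_Suc\<close> the right factor is invertible by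
  \<open>shift_invertible\<close> and can be cancelled.\<close>

lemma moment_Suc_eq_0:
  assumes "moment n M = 0"
  shows "moment (Suc n) M = 0"
proof -
  obtain R where "(E + mat (of_nat (Suc n))) ** R = mat 1"
    using shift_invertible[of n] unfolding invertible_def by blast
  moreover have "moment (Suc n) M ** (E + mat (of_nat (Suc n))) = 0"
    using assms by (simp only: moment_Suc mm.zero_right)
  ultimately show ?thesis
    by (metis matrix_mul_assoc matrix_mul_rid mm.zero_left)
qed

text \<open>If the zeroth moment vanishes, so do all later ones; \<open>moment (Suc n)\<close> has
  the regular weight \<open>u ^ n\<close>, so the continuous function \<open>core M\<close> has
  vanishing moments and is 0.\<close>

lemma moment_0_inj:
  assumes "moment 0 M = 0"
  shows "M = 0"
proof -
  have "moment n M = 0" for n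
    by (induction n) (use assms moment_Suc_eq_0 in auto)
  have "integral {0..1} (\<lambda>u. u ^ n *\<^sub>R core M u) = 0" for n
  proof -
    have "integral {0..1} (\<lambda>u. u ^ n *\<^sub>R core M u) = integral {0<..<1} (\<lambda>u. u ^ n *\<^sub>R core M u)"
      by (rule integral_open_interval_real)
    also have "\<dots> = moment (Suc n) M"
      unfolding moment_def by (intro integral_cong) auto
    finally show ?thesis using \<open>\<And>n. moment n M = 0\<close> by simp
  qed
  \<comment> \<open>At this point \<open>u\<close> and \<open>1 - u\<close> agree, so the two powers
    of \<open>A\<close> cancel and \<open>M\<close> is recovered by removing the power of
    \<open>E\<close>.\<close>
  then have "core M (1/2) = 0"
    by (intro vanishing_moments[OF continuous_on_core]) auto
  then have *: "mpowr (1/2) A ** mpowr (1/2) (- A) ** M ** mpowr (1/2) E = 0"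
    by (simp add: core_def)
  have "M = (mpowr (1/2) A ** mpowr (1/2) (- A) ** M ** mpowr (1/2) E) ** mpowr (1/2) (- E)"
    by (simp add: mpowr_minus_right flip: matrix_mul_assoc)
  then show ?thesis by (simp add: * mm.zero_left)
qed

text \<open>An injective linear endomorphism of a finite-dimensional space is onto. This replaces
  the explicit beta function normalisation of the scalar case.\<close>

lemma moment_0_surj: obtains M where "moment 0 M = N"
proof -
  have "inj (moment 0)"
    using moment_0_inj by (simp add: linear_injective_0[OF linear_moment])
  then have "surj (moment 0)"
    by (simp add: linear_injective_imp_surjective[OF linear_moment])
  then show thesis using that by (metis surjD)
qed

end

section \<open>The matrix function 1F1 on a ray\<close>

lemma mat_of_nat_add: "mat (of_nat (m + n)) = (mat (of_nat m) + mat (of_nat n) :: complex^'n^'n)"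
  by (simp add: mat_add)

lemma positive_stable_invertible:
  assumes "positive_stable P"
  shows "invertible P"
proof -
  have "\<not> eigenvalue P 0"
    using assms by (auto simp: positive_stable_def)
  then obtain R where "R ** (P - mat 0) = mat 1"
    by (rule obtain_inverse_if_not_eigenvalue)
  then show ?thesis
    by (auto simp: invertible_left_inverse)
qed

lemma positive_stable_add_nat:
  assumes "positive_stable P"
  shows "positive_stable (P + mat (of_nat n))"
  unfolding positive_stable_def
proof (intro allI impI)
  fix l assume "eigenvalue (P + mat (of_nat n)) l"
  then have "eigenvalue P (l - of_nat n)"
    by (auto simp: eigenvalue_def mv.add_left mat_vector_mult vec_eq_iff algebra_simps)
  then have "Re (l - of_nat n) > 0"
    using assms unfolding positive_stable_def by blast
  then show "Re l > 0" by simp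
qed

lemma mpochhammer_commute:
  assumes "A ** X = X ** A"
  shows "mpochhammer A n ** X = X ** mpochhammer A n"
proof (induction n)
  case (Suc n)
  have "(A + mat (of_nat n)) ** X = X ** (A + mat (of_nat n))"
    by (simp add: mm.add_left mm.add_right assms mat_mult_left mat_mult_right)
  then show ?case
    by (metis Suc.IH matrix_mul_assoc mpochhammer.simps(2))
qed simp

lemma add_mat_commute:
  fixes A X :: "complex^'n^'n"
  shows "A ** X = X ** A \<Longrightarrow> A ** (X + mat c) = (X + mat c) ** A"
  by (simp add: mm.add_left mm.add_right mat_mult_left mat_mult_right)

lemma mpochhammer_mpochhammer_commute:
  assumes "A ** B = B ** A"
  shows "mpochhammer A n ** mpochhammer B m = mpochhammer B m ** mpochhammer A n"
  by (metis assms mpochhammer_commute)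

lemma mpochhammer_add:
  "mpochhammer A (n + m) = mpochhammer A n ** mpochhammer (A + mat (of_nat n)) m"
proof (induction m)
  case (Suc m)
  then show ?case
    by (simp add: matrix_mul_assoc mat_add add.assoc)
qed simp

lemma mpochhammer_invertible:
  assumes "positive_stable B"
  shows "invertible (mpochhammer B n)"
proof (induction n)
  case 0
  show ?case by (auto simp: invertible_def)
next
  case (Suc n)
  then show ?case
    using positive_stable_invertible[OF positive_stable_add_nat[OF assms]]
    by (simp add: invertible_mult)
qed

lemma matrix_inv_left_right:
  assumes "invertible A"
  shows "matrix_inv A ** A = mat 1" "A ** matrix_inv A = mat 1"
  using assms unfolding invertible_def matrix_inv_def by (metis (mono_tags, lifting) someI_ex)+

text \<open>Positive stability of \<open>A\<close> supplies the factor \<open>u powr e\<close> at 0.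
  At 1 the power of \<open>- A\<close> may blow up, and shifting \<open>B\<close> by a large
  multiple of the identity compensates for that.\<close>

lemma obtain_beta_kernel:
  fixes A B :: "complex^'n^'n"
  assumes A: "positive_stable A" and B: "positive_stable B"
  obtains p e c where "beta_kernel A (B + mat (of_nat p)) e c"
proof -
  obtain C1 d where C1: "C1 > 0" and d: "d > 0"
    and a: "\<And>t. 0 < t \<Longrightarrow> t \<le> 1 \<Longrightarrow> norm (mpowr t A) \<le> C1 * t powr d"
    by (rule positive_stable_mpowr_bound[OF A], rule that)
  obtain C2 L where C2: "C2 \<ge> 0" "L \<ge> 0"
    and a': "\<And>t. 0 < t \<Longrightarrow> t \<le> 1 \<Longrightarrow> norm (mpowr t (- A)) \<le> C2 * t powr (- L)"
    by (rule mpowr_bound[of "- A"], rule that)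
  obtain C3 d3 where C3: "C3 > 0" "d3 > 0"
    and b: "\<And>t. 0 < t \<Longrightarrow> t \<le> 1 \<Longrightarrow> norm (mpowr t B) \<le> C3 * t powr d3"
    by (rule positive_stable_mpowr_bound[OF B], rule that)
  obtain K where K: "\<And>(A::complex^'n^'n) (B::complex^'n^'n). norm (A ** B) \<le> norm A * norm B * K" "K \<ge> 0"
    using mm.nonneg_bounded by blast
  \<comment> \<open>Of the exponent \<open>L + 1\<close>, the part \<open>L\<close> cancels the
    growth of \<open>mpowr (1 - u) (- A)\<close> and the remaining 1 is the factor
    \<open>1 - u\<close> in the kernel bound.\<close>
  define p where "p = nat \<lceil>L + 1\<rceil>"
  have p: "real p \<ge> L + 1" unfolding p_def by (rule real_nat_ceiling_ge)
  define c where "c = K ^ 3 * C1 * C2 * C3"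
  have "beta_kernel A (B + mat (of_nat p)) d c"
  proof
    show "d > 0" by fact
    show "c \<ge> 0" using C1 C2 C3 K by (simp add: c_def)
    show "invertible (B + mat (of_nat p) + mat (of_nat (Suc n)))" for n
      using positive_stable_invertible[OF positive_stable_add_nat[OF B, of "p + Suc n"]]
      by (simp only: mat_of_nat_add add.assoc)
    fix u :: real and M :: "complex^'n^'n"
    assume u: "0 < u" "u < 1"
    let ?v = "1 - u"
    have E: "mpowr ?v (B + mat (of_nat p)) = ?v powr real p *\<^sub>R mpowr ?v B"
      using mpowr_add_mat[of ?v B "real p"] u by simp
    have nE: "norm (mpowr ?v (B + mat (of_nat p))) \<le> C3 * ?v powr (L + 1)"
    proof -
      have "norm (mpowr ?v (B + mat (of_nat p))) = ?v powr real p * norm (mpowr ?v B)"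
        by (simp add: E)
      also have "\<dots> \<le> ?v powr (L + 1) * (C3 * 1)"
      proof (intro mult_mono)
        show "?v powr real p \<le> ?v powr (L + 1)"
          using u p by (intro powr_mono') auto
        have "norm (mpowr ?v B) \<le> C3 * ?v powr d3"
          using u by (intro b) auto
        also have "\<dots> \<le> C3 * 1"
          using u C3 by (intro mult_left_mono powr_le1) auto
        finally show "norm (mpowr ?v B) \<le> C3 * 1" .
      qed auto
      finally show ?thesis by (simp add: mult.commute)
    qed
    have "norm (mpowr u A ** mpowr ?v (- A) ** M ** mpowr ?v (B + mat (of_nat p)))
       \<le> norm (mpowr u A ** mpowr ?v (- A) ** M) * norm (mpowr ?v (B + mat (of_nat p))) * K"
      by (rule K)
    also have "\<dots> \<le> (norm (mpowr u A ** mpowr ?v (- A)) * norm M * K) * norm (mpowr ?v (B + mat (of_nat p))) * K"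
      by (intro mult_right_mono K norm_ge_zero)
    also have "\<dots> \<le> ((norm (mpowr u A) * norm (mpowr ?v (- A)) * K) * norm M * K) * norm (mpowr ?v (B + mat (of_nat p))) * K"
      by (intro mult_right_mono K norm_ge_zero)
    also have "\<dots> = (norm (mpowr u A) * norm (mpowr ?v (- A)) * norm (mpowr ?v (B + mat (of_nat p)))) * (norm M * K ^ 3)"
      by (simp add: power3_eq_cube mult_ac)
    also have "\<dots> \<le> ((C1 * u powr d) * (C2 * ?v powr (- L)) * (C3 * ?v powr (L + 1))) * (norm M * K ^ 3)"
      using u C1 C2 C3 K by (intro mult_right_mono mult_mono a a' nE) auto
    also have "\<dots> = c * norm M * (u powr d * (?v powr (- L) * ?v powr (L + 1)))"
      by (simp add: c_def mult_ac)
    also have "?v powr (- L) * ?v powr (L + 1) = ?v"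
      using u by (simp flip: powr_add)
    finally show "norm (mpowr u A ** mpowr ?v (- A) ** M ** mpowr ?v (B + mat (of_nat p)))
       \<le> c * norm M * (u powr d * ?v)" .
  qed
  then show thesis by (rule that)
qed

section \<open>The exponential series with Pochhammer weights\<close>

definition hseries :: "nat \<Rightarrow> complex^'n^'n \<Rightarrow> complex^'n^'n \<Rightarrow> nat \<Rightarrow> complex^'n^'n" where
  "hseries m C W n = mpochhammer (C + mat (of_nat n)) m ** ((1 / fact n) *\<^sub>R mpower W n)"

lemma hseries_Suc_0:
  "hseries (Suc m) C W 0 = (C + mat (of_nat m)) ** hseries m C W 0"
  by (simp add: hseries_def) (rule mpochhammer_commute, rule add_mat_commute, rule refl)

text \<open>The last Pochhammer factor is \<open>C + mat (of_nat m)\<close> plus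
  \<open>n + 1\<close> times the identity. The second part cancels against the factorial, lowers the
  power of \<open>W\<close> by one and turns \<open>C\<close> into \<open>C + mat 1\<close>.\<close>

lemma hseries_Suc_Suc:
  "hseries (Suc m) C W (Suc n) = (C + mat (of_nat m)) ** hseries m C W (Suc n) + hseries m (C + mat 1) W n ** W"
proof -
  let ?p = "mpochhammer (C + mat (of_nat (Suc n))) m"
  let ?w = "(1 / fact (Suc n)) *\<^sub>R mpower W (Suc n)"
  have comm: "?p ** (C + mat (of_nat m)) = (C + mat (of_nat m)) ** ?p"
    by (intro mpochhammer_commute add_mat_commute) (rule add_mat_commute[symmetric], rule refl)
  have distr: "P ** (X + mat k) ** Q = X ** (P ** Q) + k *\<^sub>M (P ** Q)"
    if "P ** X = X ** P" for P X Q :: "complex^'a^'a" and k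
    by (simp add: mm.add_right mm.add_left that mat_mult_right mscale_mult_left matrix_mul_assoc)
  have "hseries (Suc m) C W (Suc n) = ?p ** (C + mat (of_nat m) + mat (of_nat (Suc n))) ** ?w"
    by (simp add: hseries_def add_ac)
  also have "\<dots> = (C + mat (of_nat m)) ** (?p ** ?w) + of_nat (Suc n) *\<^sub>M (?p ** ?w)"
    by (rule distr[OF comm])
  also have "of_nat (Suc n) *\<^sub>M (?p ** ?w) = of_nat (Suc n) *\<^sub>R (?p ** ?w)"
    by (metis mscale_of_real of_real_of_nat_eq)
  also have "\<dots> = (?p ** ((1 / fact n) *\<^sub>R mpower W n)) ** W"
    by (simp add: mm.scaleR_right mm.scaleR_left matrix_mul_assoc field_simps del: of_nat_Suc)
  also have "?p = mpochhammer (C + mat 1 + mat (of_nat n)) m"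
    by (simp add: mat_add add.assoc)
  finally show ?thesis
    by (simp add: hseries_def mat_add add.assoc)
qed

lemma summable_norm_hseries: "summable (\<lambda>n. norm (hseries m C W n))"
proof (induction m arbitrary: C)
  case 0
  show ?case using summable_norm_mexp[of W] by (simp add: hseries_def)
next
  case (Suc m)
  obtain K where K: "\<And>(A::complex^'a^'a) (B::complex^'a^'a). norm (A ** B) \<le> norm A * norm B * K" "K \<ge> 0"
    using mm.nonneg_bounded by blast
  have "summable (\<lambda>n. norm (hseries (Suc m) C W (Suc n)))"
  proof (rule summable_comparison_test')
    show "summable (\<lambda>n. norm (C + mat (of_nat m)) * norm (hseries m C W (Suc n)) * K
            + norm (hseries m (C + mat 1) W n) * norm W * K)"
      using Suc.IH[of C] Suc.IH[of "C + mat 1"]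
      by (intro summable_add summable_mult2 summable_mult) (simp_all only: summable_Suc_iff[of "\<lambda>n. norm (hseries m C W n)"])
    show "norm (norm (hseries (Suc m) C W (Suc n))) \<le> norm (C + mat (of_nat m)) * norm (hseries m C W (Suc n)) * K
            + norm (hseries m (C + mat 1) W n) * norm W * K" if "n \<ge> 0" for n
      unfolding hseries_Suc_Suc real_norm_def abs_norm_cancel
      by (rule order_trans[OF norm_triangle_ineq]) (intro add_mono K)
  qed
  then show ?case by (simp only: summable_Suc_iff[of "\<lambda>n. norm (hseries (Suc m) C W n)"])
qed

definition hsum :: "nat \<Rightarrow> complex^'n^'n \<Rightarrow> complex^'n^'n \<Rightarrow> complex^'n^'n" where
  "hsum m C W = (\<Sum>n. hseries m C W n)"

lemma sums_hsum: "hseries m C W sums hsum m C W"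
  unfolding hsum_def by (rule summable_sums[OF summable_norm_cancel[OF summable_norm_hseries]])

lemma hsum_0: "hsum 0 C W = mexp W"
  by (simp add: hsum_def hseries_def mexp_def)

text \<open>Iterated down to \<open>hsum_0\<close>, this shows that \<open>hsum m C W\<close> is
  \<open>mexp W\<close> with polynomial factors: coefficients built from \<open>C\<close> on the
  left, powers of \<open>W\<close> on the right.\<close>

lemma hsum_Suc: "hsum (Suc m) C W = (C + mat (of_nat m)) ** hsum m C W + hsum m (C + mat 1) W ** W"
proof -
  have "(\<lambda>n. hseries m C W (Suc n)) sums (hsum m C W - hseries m C W 0)"
    using sums_hsum[of m C W] by (simp add: sums_Suc_iff)
  then have "(\<lambda>n. hseries (Suc m) C W (Suc n)) sums
      ((C + mat (of_nat m)) ** (hsum m C W - hseries m C W 0) + hsum m (C + mat 1) W ** W)"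
    unfolding hseries_Suc_Suc
    by (intro sums_add bounded_linear.sums[OF mm.bounded_linear_right]
        bounded_linear.sums[OF mm.bounded_linear_left] sums_hsum)
  then have "hseries (Suc m) C W sums
      ((C + mat (of_nat m)) ** (hsum m C W - hseries m C W 0) + hsum m (C + mat 1) W ** W + hseries (Suc m) C W 0)"
    by (rule sums_Suc)
  from sums_unique2[OF sums_hsum this] show ?thesis
    by (simp add: hseries_Suc_0 mm.diff_right)
qed

lemma mpower_scaleR: "mpower (s *\<^sub>R W) n = s ^ n *\<^sub>R mpower W n"
  by (induction n) (simp_all add: mm.scaleR_left mm.scaleR_right mult.commute)

lemma power_le_fact_exp:
  fixes x :: real
  assumes "x \<ge> 0"
  shows "x ^ k \<le> fact k * exp x"
proof -
  have "(\<Sum>n\<in>{k}. x ^ n /\<^sub>R fact n) \<le> (\<Sum>n. x ^ n /\<^sub>R fact n)"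
    using assms by (intro sum_le_suminf summable_exp_generic) auto
  then have "x ^ k /\<^sub>R fact k \<le> exp x" by (simp add: exp_def)
  then show ?thesis by (simp add: field_simps)
qed

text \<open>The extra power on the right closes the induction, since each use of
  \<open>hsum_Suc\<close> puts one more factor \<open>W\<close> there. For \<open>m = 0\<close>
  exponential decay beats every power of \<open>s\<close>.\<close>

lemma hsum_mpower_bounded:
  assumes "positive_stable Y"
  shows "\<exists>K. \<forall>s\<ge>0. norm (hsum m C (- (s *\<^sub>R Y)) ** mpower (- (s *\<^sub>R Y)) k) \<le> K"
proof (induction m arbitrary: C k)
  case 0
  obtain C1 d where C1: "C1 > 0" "d > 0" and decay: "\<And>s. s \<ge> 0 \<Longrightarrow> norm (mexp (- (s *\<^sub>R Y))) \<le> C1 * exp (- d * s)"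
    by (rule positive_stable_exp_decay[OF assms], rule that)
  obtain K where K: "\<And>(A::complex^'a^'a) (B::complex^'a^'a). norm (A ** B) \<le> norm A * norm B * K" "K \<ge> 0"
    using mm.nonneg_bounded by blast
  have "norm (hsum 0 C (- (s *\<^sub>R Y)) ** mpower (- (s *\<^sub>R Y)) k) \<le> C1 * (fact k / d ^ k) * norm (mpower (- Y) k) * K"
    if s: "s \<ge> 0" for s
  proof -
    have "mpower (- (s *\<^sub>R Y)) k = s ^ k *\<^sub>R mpower (- Y) k"
      using mpower_scaleR[of s "- Y" k] by simp
    then have "norm (hsum 0 C (- (s *\<^sub>R Y)) ** mpower (- (s *\<^sub>R Y)) k)
      \<le> norm (mexp (- (s *\<^sub>R Y))) * (s ^ k * norm (mpower (- Y) k)) * K"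
      using K(1)[of "mexp (- (s *\<^sub>R Y))" "mpower (- (s *\<^sub>R Y)) k"] s by (simp add: hsum_0)
    also have "\<dots> \<le> (C1 * exp (- d * s)) * (s ^ k * norm (mpower (- Y) k)) * K"
      using K(2) s by (intro mult_right_mono decay) auto
    also have "\<dots> = C1 * (exp (- d * s) * s ^ k) * norm (mpower (- Y) k) * K"
      by simp
    also have "\<dots> \<le> C1 * (fact k / d ^ k) * norm (mpower (- Y) k) * K"
    proof (intro mult_right_mono mult_left_mono)
      have "(d * s) ^ k \<le> fact k * exp (d * s)"
        using C1 s by (intro power_le_fact_exp) auto
      then show "exp (- d * s) * s ^ k \<le> fact k / d ^ k"
        using C1 by (simp add: exp_minus field_simps power_mult_distrib)
    qed (use C1 K in auto)
    finally show ?thesis .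
  qed
  then show ?case by blast
next
  case (Suc m)
  obtain K where K: "\<And>(A::complex^'a^'a) (B::complex^'a^'a). norm (A ** B) \<le> norm A * norm B * K" "K \<ge> 0"
    using mm.nonneg_bounded by blast
  obtain K1 where K1: "\<And>s. s \<ge> 0 \<Longrightarrow> norm (hsum m C (- (s *\<^sub>R Y)) ** mpower (- (s *\<^sub>R Y)) k) \<le> K1"
    using Suc.IH[of C k] by blast
  obtain K2 where K2: "\<And>s. s \<ge> 0 \<Longrightarrow> norm (hsum m (C + mat 1) (- (s *\<^sub>R Y)) ** mpower (- (s *\<^sub>R Y)) (Suc k)) \<le> K2"
    using Suc.IH[of "C + mat 1" "Suc k"] by blast
  have "norm (hsum (Suc m) C (- (s *\<^sub>R Y)) ** mpower (- (s *\<^sub>R Y)) k) \<le> norm (C + mat (of_nat m)) * K1 * K + K2"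
    if s: "s \<ge> 0" for s
  proof -
    let ?W = "- (s *\<^sub>R Y)"
    have "?W ** mpower ?W k = mpower ?W k ** ?W"
      by (simp add: mpower_commute)
    then have "hsum (Suc m) C ?W ** mpower ?W k
      = (C + mat (of_nat m)) ** (hsum m C ?W ** mpower ?W k) + hsum m (C + mat 1) ?W ** mpower ?W (Suc k)"
      by (simp add: hsum_Suc mm.add_left flip: matrix_mul_assoc)
    then have "norm (hsum (Suc m) C ?W ** mpower ?W k) \<le> norm ((C + mat (of_nat m)) ** (hsum m C ?W ** mpower ?W k))
        + norm (hsum m (C + mat 1) ?W ** mpower ?W (Suc k))"
      by (metis norm_triangle_ineq)
    also have "\<dots> \<le> norm (C + mat (of_nat m)) * norm (hsum m C ?W ** mpower ?W k) * K + K2"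
      by (intro add_mono K K2 s)
    also have "\<dots> \<le> norm (C + mat (of_nat m)) * K1 * K + K2"
      using K K1[OF s] by (intro add_mono mult_right_mono mult_left_mono) auto
    finally show ?thesis .
  qed
  then show ?case by blast
qed

lemma hsum_bounded:
  assumes "positive_stable Y"
  obtains K where "K \<ge> 0" "\<And>s. s \<ge> 0 \<Longrightarrow> norm (hsum m C (- (s *\<^sub>R Y))) \<le> K"
proof -
  obtain K where K: "\<And>s. s \<ge> 0 \<Longrightarrow> norm (hsum m C (- (s *\<^sub>R Y))) \<le> K"
    using hsum_mpower_bounded[OF assms, of m C 0] by auto
  moreover have "K \<ge> 0"
    using order_trans[OF norm_ge_zero K[of 0]] by simp
  ultimately show thesis using that by blast
qed

section \<open>The hypergeometric series as an integral of the kernel\<close>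

lemma sums_integral_dominated:
  fixes f :: "nat \<Rightarrow> real \<Rightarrow> 'b::euclidean_space"
  assumes f: "\<And>n. f n integrable_on S" and h: "h integrable_on S"
    and bound: "\<And>N x. x \<in> S \<Longrightarrow> norm (\<Sum>n<N. f n x) \<le> h x"
    and lim: "\<And>x. x \<in> S \<Longrightarrow> (\<lambda>n. f n x) sums g x"
  shows "g integrable_on S" "(\<lambda>n. integral S (f n)) sums integral S g"
proof -
  have int: "(\<lambda>x. \<Sum>n<N. f n x) integrable_on S" for N
    by (intro integrable_sum f finite_lessThan)
  show "g integrable_on S"
    by (rule dominated_convergence(1)[OF int h bound]) (use lim in \<open>auto simp: sums_def\<close>)
  have "(\<lambda>N. integral S (\<lambda>x. \<Sum>n<N. f n x)) \<longlonglongrightarrow> integral S g"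
    by (rule dominated_convergence(2)[OF int h bound]) (use lim in \<open>auto simp: sums_def\<close>)
  then show "(\<lambda>n. integral S (f n)) sums integral S g"
    by (simp add: sums_def integral_sum f)
qed

context beta_kernel
begin

text \<open>Iteration of \<open>moment_Suc\<close>: the factors in \<open>A\<close> collect on the
  left and those in \<open>E\<close> on the right, and only factors in the same matrix are
  interchanged.\<close>

lemma moment_mpochhammer: "moment n M ** mpochhammer (E + mat 1) n = mpochhammer A n ** moment 0 M"
proof (induction n)
  case (Suc n)
  have eq: "E + mat 1 + mat (of_nat n) = E + mat (of_nat (Suc n))"
    by (simp add: mat_add add.assoc)
  have comm: "mpochhammer (E + mat 1) n ** (E + mat (of_nat (Suc n)))
      = (E + mat (of_nat (Suc n))) ** mpochhammer (E + mat 1) n"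
    by (intro mpochhammer_commute add_mat_commute) (rule add_mat_commute[symmetric], rule refl)
  have comm': "(A + mat (of_nat n)) ** mpochhammer A n = mpochhammer A n ** (A + mat (of_nat n))"
    by (rule mpochhammer_commute[symmetric], rule add_mat_commute, rule refl)
  have "moment (Suc n) M ** mpochhammer (E + mat 1) (Suc n)
      = (moment (Suc n) M ** (E + mat (of_nat (Suc n)))) ** mpochhammer (E + mat 1) n"
    by (simp only: mpochhammer.simps eq comm matrix_mul_assoc)
  also have "\<dots> = (A + mat (of_nat n)) ** (moment n M ** mpochhammer (E + mat 1) n)"
    by (simp only: moment_Suc matrix_mul_assoc)
  also have "\<dots> = mpochhammer A (Suc n) ** moment 0 M"
    by (simp only: Suc.IH matrix_mul_assoc comm' mpochhammer.simps)
  finally show ?case .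
qed simp

text \<open>The factor \<open>u ^ n\<close> of the moment is absorbed into the argument, turning
  \<open>W\<close> into \<open>u *\<^sub>R W\<close>. Sum and integral are interchanged by dominated
  convergence, the series of norms times \<open>u powr (e - 1)\<close> being the majorant.\<close>

lemma series_integral:
  shows "(\<lambda>u. (1 / u) *\<^sub>R core M u ** hsum m C (u *\<^sub>R W)) integrable_on {0<..<1}"
    and "(\<lambda>n. moment n M ** hseries m C W n) sums
      integral {0<..<1} (\<lambda>u. (1 / u) *\<^sub>R core M u ** hsum m C (u *\<^sub>R W))"
proof -
  let ?f = "\<lambda>n u. ((u ^ n / u) *\<^sub>R core M u) ** hseries m C W n"
  obtain K where K: "\<And>(A::complex^'n^'n) (B::complex^'n^'n). norm (A ** B) \<le> norm A * norm B * K" "K \<ge> 0"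
    using mm.nonneg_bounded by blast
  let ?S = "\<Sum>n. norm (hseries m C W n)"
  have int: "(?f n has_integral moment n M ** hseries m C W n) {0<..<1}" for n
    using has_integral_linear[OF has_integral_moment mm.bounded_linear_left] by (simp add: o_def)
  have *: "?f n integrable_on {0<..<1}" for n
    using int by blast
  have bound: "norm (\<Sum>n<N. ?f n u) \<le> (c * norm M * ?S * K) * u powr (e - 1)" if u: "u \<in> {0<..<1}" for N u
  proof -
    let ?b = "c * norm M * u powr (e - 1)"
    have b: "?b \<ge> 0" using c_nonneg by simp
    have "norm (\<Sum>n<N. ?f n u) \<le> (\<Sum>n<N. ?b * norm (hseries m C W n) * K)"
    proof (rule sum_norm_le)
      fix n
      have "norm (?f n u) \<le> norm ((u ^ n / u) *\<^sub>R core M u) * norm (hseries m C W n) * K"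
        by (rule K)
      also have "\<dots> \<le> ?b * norm (hseries m C W n) * K"
        using u K by (intro mult_right_mono integrand_bound) auto
      finally show "norm (?f n u) \<le> ?b * norm (hseries m C W n) * K" .
    qed
    also have "\<dots> = ?b * K * (\<Sum>n<N. norm (hseries m C W n))"
      by (simp add: sum_distrib_left mult_ac)
    also have "\<dots> \<le> ?b * K * ?S"
      using b K by (intro mult_left_mono sum_le_suminf summable_norm_hseries) auto
    finally show ?thesis by (simp add: mult_ac)
  qed
  have lim: "(\<lambda>n. ?f n u) sums ((1 / u) *\<^sub>R core M u ** hsum m C (u *\<^sub>R W))" for u
  proof -
    have "?f n u = ((1 / u) *\<^sub>R core M u) ** hseries m C (u *\<^sub>R W) n" for n
      by (simp add: hseries_def mpower_scaleR mm.scaleR_left mm.scaleR_right mult_ac)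
    then show ?thesis
      by (simp only: bounded_linear.sums[OF mm.bounded_linear_right sums_hsum])
  qed
  note dom = sums_integral_dominated[OF * integrable_powr_Ioo[OF e_pos] bound lim]
  show "(\<lambda>u. (1 / u) *\<^sub>R core M u ** hsum m C (u *\<^sub>R W)) integrable_on {0<..<1}"
    by (rule dom(1))
  show "(\<lambda>n. moment n M ** hseries m C W n) sums
      integral {0<..<1} (\<lambda>u. (1 / u) *\<^sub>R core M u ** hsum m C (u *\<^sub>R W))"
    using dom(2) by (simp only: integral_unique[OF int])
qed

end

lemma hyp1F1_representation:
  fixes A B :: "complex^'n^'n"
  assumes A: "positive_stable A" and B: "positive_stable B"
  obtains p e c M where "beta_kernel A (B + mat (of_nat p)) e c"
    "\<And>W n. mpochhammer A n ** matrix_inv (mpochhammer B n) ** ((1 / fact n) *\<^sub>R mpower W n)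
      = beta_kernel.moment A (B + mat (of_nat p)) n M ** hseries (Suc p) B W n"
proof -
  obtain p e c where bk: "beta_kernel A (B + mat (of_nat p)) e c"
    by (rule obtain_beta_kernel[OF A B])
  interpret beta_kernel A "B + mat (of_nat p)" e c by (rule bk)
  let ?m = "Suc p"
  \<comment> \<open>Since \<open>E + mat 1\<close> is \<open>B\<close> shifted by
    \<open>?m = Suc p\<close>, the Pochhammer product to be compensated has exactly
    \<open>Suc p\<close> factors.\<close>
  obtain M where M: "moment 0 M = matrix_inv (mpochhammer B ?m)"
    by (rule moment_0_surj)
  have "moment n M ** mpochhammer (B + mat (of_nat n)) ?m = mpochhammer A n ** matrix_inv (mpochhammer B n)" for n
  proof -
    let ?Q = "mpochhammer (B + mat (of_nat n)) ?m"
    have eq: "B + mat (of_nat p) + mat 1 = B + mat (of_nat ?m)"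
      by (simp add: mat_add add_ac)
    \<comment> \<open>Both ways of splitting the product with \<open>?m + n\<close> factors are
      compared; all factors involved are shifts of \<open>B\<close> and commute. The choice of
      \<open>M\<close> then cancels \<open>mpochhammer B ?m\<close>.\<close>
    have "?Q ** mpochhammer B n = mpochhammer B n ** ?Q"
      by (rule mpochhammer_mpochhammer_commute) (rule add_mat_commute[symmetric], rule refl)
    also have "\<dots> = mpochhammer B (?m + n)"
      by (metis add.commute mpochhammer_add)
    also have "\<dots> = mpochhammer B ?m ** mpochhammer (B + mat (of_nat ?m)) n"
      by (rule mpochhammer_add)
    also have "\<dots> = mpochhammer (B + mat (of_nat ?m)) n ** mpochhammer B ?m"
      by (rule mpochhammer_mpochhammer_commute) (rule add_mat_commute, rule refl)
    finally have "moment n M ** ?Q ** mpochhammer B n = (moment n M ** mpochhammer (B + mat (of_nat ?m)) n) ** mpochhammer B ?m"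
      by (simp only: matrix_mul_assoc[symmetric])
    also have "\<dots> = mpochhammer A n ** (matrix_inv (mpochhammer B ?m) ** mpochhammer B ?m)"
      using moment_mpochhammer[of n M] by (simp only: eq M matrix_mul_assoc)
    also have "\<dots> = mpochhammer A n"
      by (simp only: matrix_inv_left_right[OF mpochhammer_invertible[OF B]] matrix_mul_rid)
    finally have "moment n M ** ?Q ** mpochhammer B n ** matrix_inv (mpochhammer B n) = mpochhammer A n ** matrix_inv (mpochhammer B n)"
      by (rule arg_cong)
    then show ?thesis
      by (simp only: matrix_mul_assoc[symmetric] matrix_inv_left_right[OF mpochhammer_invertible[OF B]] matrix_mul_rid)
  qed
  then have "mpochhammer A n ** matrix_inv (mpochhammer B n) ** ((1 / fact n) *\<^sub>R mpower W n)
      = moment n M ** hseries ?m B W n" for n W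
    by (simp only: hseries_def matrix_mul_assoc)
  then show thesis using that bk by blast
qed

text \<open>The representation holds term by term, so convergence is inherited from
  \<open>series_integral\<close>.\<close>

lemma sums_hyp1F1:
  assumes "positive_stable A" "positive_stable B"
  shows "(\<lambda>n. mpochhammer A n ** matrix_inv (mpochhammer B n) ** ((1 / fact n) *\<^sub>R mpower W n)) sums hyp1F1 A B W"
proof -
  obtain p e c M where bk: "beta_kernel A (B + mat (of_nat p)) e c"
    and rep: "\<And>W n. mpochhammer A n ** matrix_inv (mpochhammer B n) ** ((1 / fact n) *\<^sub>R mpower W n)
      = beta_kernel.moment A (B + mat (of_nat p)) n M ** hseries (Suc p) B W n"
    by (rule hyp1F1_representation[OF assms], rule that)
  show ?thesis
    unfolding hyp1F1_def rep
    by (rule summable_sums[OF sums_summable[OF beta_kernel.series_integral(2)[OF bk]]])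
qed

text \<open>Scaling by \<open>u\<close> keeps the argument \<open>- (s *\<^sub>R Y)\<close> on the
  same ray, where \<open>hsum\<close> is uniformly bounded. What remains is the integral of a
  constant times \<open>u powr (e - 1)\<close>, independent of \<open>s\<close>.\<close>

lemma hyp1F1_bounded:
  fixes A B Y :: "complex^'n^'n"
  assumes "positive_stable A" "positive_stable B" "positive_stable Y"
  obtains K where "K \<ge> 0" "\<And>s. s \<ge> 0 \<Longrightarrow> norm (hyp1F1 A B (- (s *\<^sub>R Y))) \<le> K"
proof -
  obtain p e c M where bk: "beta_kernel A (B + mat (of_nat p)) e c"
    and rep: "\<And>W n. mpochhammer A n ** matrix_inv (mpochhammer B n) ** ((1 / fact n) *\<^sub>R mpower W n)
      = beta_kernel.moment A (B + mat (of_nat p)) n M ** hseries (Suc p) B W n"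
    by (rule hyp1F1_representation[OF assms(1,2)], rule that)
  interpret beta_kernel A "B + mat (of_nat p)" e c by (rule bk)
  obtain K where K: "\<And>(A::complex^'n^'n) (B::complex^'n^'n). norm (A ** B) \<le> norm A * norm B * K" "K \<ge> 0"
    using mm.nonneg_bounded by blast
  obtain K' where K': "K' \<ge> 0" "\<And>s. s \<ge> 0 \<Longrightarrow> norm (hsum (Suc p) B (- (s *\<^sub>R Y))) \<le> K'"
    by (rule hsum_bounded[OF assms(3), of "Suc p" B], rule that)
  let ?h = "\<lambda>u. (c * norm M * K' * K) * u powr (e - 1)"
  have "norm (hyp1F1 A B (- (s *\<^sub>R Y))) \<le> integral {0<..<1} ?h" if s: "s \<ge> 0" for s
  proof -
    have "hyp1F1 A B (- (s *\<^sub>R Y)) = integral {0<..<1} (\<lambda>u. (1 / u) *\<^sub>R core M u ** hsum (Suc p) B (u *\<^sub>R (- (s *\<^sub>R Y))))"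
      using sums_hyp1F1[OF assms(1,2)] unfolding rep by (rule sums_unique2[OF _ series_integral(2)])
    also have "norm \<dots> \<le> integral {0<..<1} ?h"
    proof (rule integral_norm_bound_integral[OF series_integral(1) integrable_powr_Ioo[OF e_pos]])
      fix u :: real assume u: "u \<in> {0<..<1}"
      have "norm ((1 / u) *\<^sub>R core M u ** hsum (Suc p) B (u *\<^sub>R (- (s *\<^sub>R Y))))
         \<le> norm ((1 / u) *\<^sub>R core M u) * norm (hsum (Suc p) B (- ((u * s) *\<^sub>R Y))) * K"
        using K(1)[of "(1 / u) *\<^sub>R core M u" "hsum (Suc p) B (- ((u * s) *\<^sub>R Y))"]
        by (simp only: scaleR_minus_right scaleR_scaleR)
      also have "\<dots> \<le> (c * norm M * u powr (e - 1)) * K' * K"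
        using u s K K' c_nonneg integrand_bound[of u 0 M] by (intro mult_right_mono mult_mono) auto
      finally show "norm ((1 / u) *\<^sub>R core M u ** hsum (Suc p) B (u *\<^sub>R (- (s *\<^sub>R Y)))) \<le> ?h u"
        by (simp add: mult_ac)
    qed
    finally show ?thesis .
  qed
  moreover have "integral {0<..<1} ?h \<ge> 0"
    using c_nonneg K K' by (intro integral_nonneg integrable_powr_Ioo e_pos) auto
  ultimately show thesis using that by blast
qed

section \<open>The extended functions\<close>

definition ext_integrand ::
  "complex^'n^'n \<Rightarrow> complex^'n^'n \<Rightarrow> complex^'n^'n \<Rightarrow> complex^'n^'n \<Rightarrow> complex^'n^'n \<Rightarrow> real \<Rightarrow> complex^'n^'n"
where
  "ext_integrand A B Y P Q t =
     hyp1F1 A B (- ((1 / (t * (1 - t))) *\<^sub>R Y)) ** mpowr t (P - mat 1) ** mpowr (1 - t) (Q - mat 1)"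

text \<open>A pointwise limit of functions continuous on the open interval, obtained by truncating
  the hypergeometric series.\<close>

lemma ext_integrand_measurable:
  assumes "positive_stable A" "positive_stable B"
  shows "ext_integrand A B Y P Q \<in> borel_measurable (lebesgue_on {0<..<1})"
proof (rule borel_measurable_LIMSEQ_metric)
  let ?x = "\<lambda>t::real. 1 / (t * (1 - t))"
  let ?a = "\<lambda>n. mpochhammer A n ** matrix_inv (mpochhammer B n) ** ((1 / fact n) *\<^sub>R mpower (- Y) n)"
  let ?f = "\<lambda>N t. (\<Sum>n<N. ?x t ^ n *\<^sub>R ?a n) ** mpowr t (P - mat 1) ** mpowr (1 - t) (Q - mat 1)"
  show "?f N \<in> borel_measurable (lebesgue_on {0<..<1})" for N
    by (intro continuous_imp_measurable_on_sets_lebesgue mm.continuous_on continuous_intros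
        continuous_on_mpowr continuous_on_mpowr_one_minus) auto
  fix t
  have "mpower (- (?x t *\<^sub>R Y)) n = ?x t ^ n *\<^sub>R mpower (- Y) n" for n
    using mpower_scaleR[of "?x t" "- Y" n] by simp
  then have *: "mpochhammer A n ** matrix_inv (mpochhammer B n) ** ((1 / fact n) *\<^sub>R mpower (- (?x t *\<^sub>R Y)) n)
      = ?x t ^ n *\<^sub>R ?a n" for n
    by (simp only: mm.scaleR_right scaleR_left_commute)
  have "(\<lambda>n. ?x t ^ n *\<^sub>R ?a n) sums hyp1F1 A B (- (?x t *\<^sub>R Y))"
    using sums_hyp1F1[OF assms, of "- (?x t *\<^sub>R Y)"] unfolding * .
  then show "(\<lambda>N. ?f N t) \<longlonglongrightarrow> ext_integrand A B Y P Q t"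
    unfolding ext_integrand_def sums_def
    by (intro bounded_linear.tendsto[OF mm.bounded_linear_left])
qed

text \<open>Since \<open>1 / (t * (1 - t))\<close> is nonnegative, the hypergeometric factor is
  bounded, and the two matrix powers leave a scalar beta integrand with positive parameters
  \<open>d1\<close> and \<open>d2\<close>.\<close>

lemma ext_integrand_dominated:
  fixes A B Y P Q :: "complex^'n^'n"
  assumes "positive_stable A" "positive_stable B" "positive_stable Y" "positive_stable P" "positive_stable Q"
  obtains h where "h integrable_on {0<..<1}"
    "\<And>t. 0 < t \<Longrightarrow> t < 1 \<Longrightarrow> norm (ext_integrand A B Y P Q t) \<le> h t"
proof -
  obtain K0 where K0: "K0 \<ge> 0" "\<And>s. s \<ge> 0 \<Longrightarrow> norm (hyp1F1 A B (- (s *\<^sub>R Y))) \<le> K0"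
    by (rule hyp1F1_bounded[OF assms(1-3)], rule that)
  obtain C1 d1 where C1: "C1 > 0" "d1 > 0"
    and P: "\<And>t. 0 < t \<Longrightarrow> t \<le> 1 \<Longrightarrow> norm (mpowr t P) \<le> C1 * t powr d1"
    by (rule positive_stable_mpowr_bound[OF assms(4)], rule that)
  obtain C2 d2 where C2: "C2 > 0" "d2 > 0"
    and Q: "\<And>t. 0 < t \<Longrightarrow> t \<le> 1 \<Longrightarrow> norm (mpowr t Q) \<le> C2 * t powr d2"
    by (rule positive_stable_mpowr_bound[OF assms(5)], rule that)
  obtain K where K: "\<And>(A::complex^'n^'n) (B::complex^'n^'n). norm (A ** B) \<le> norm A * norm B * K" "K \<ge> 0"
    using mm.nonneg_bounded by blast
  define h where "h t = (K0 * C1 * C2 * K ^ 2) * (t powr (d1 - 1) * (1 - t) powr (d2 - 1))" for t :: real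
  have shift: "norm (mpowr t (M - mat 1)) \<le> C * t powr (d - 1)"
    if "norm (mpowr t M) \<le> C * t powr d" "t > 0" for t C d and M :: "complex^'n^'n"
    using that by (simp add: mpowr_diff_mat_1 powr_diff divide_right_mono)
  show thesis
  proof (rule that[of h])
    show "h integrable_on {0<..<1}"
      using has_integral_Beta_real[OF C1(2) C2(2)] unfolding h_def integrable_on_open_interval_real
      by (intro integrable_on_mult_right) blast
    fix t :: real assume t: "0 < t" "t < 1"
    let ?F = "hyp1F1 A B (- ((1 / (t * (1 - t))) *\<^sub>R Y))"
    let ?p = "mpowr t (P - mat 1)" and ?q = "mpowr (1 - t) (Q - mat 1)"
    have "norm (ext_integrand A B Y P Q t) \<le> norm (?F ** ?p) * norm ?q * K"
      unfolding ext_integrand_def by (rule K)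
    also have "\<dots> \<le> (norm ?F * norm ?p * K) * norm ?q * K"
      by (intro mult_right_mono K norm_ge_zero)
    also have "\<dots> = (norm ?F * norm ?p * norm ?q) * K ^ 2"
      by (simp add: power2_eq_square mult_ac)
    also have "\<dots> \<le> (K0 * (C1 * t powr (d1 - 1)) * (C2 * (1 - t) powr (d2 - 1))) * K ^ 2"
      using t K0 C1 C2 by (intro mult_right_mono mult_mono K0(2) shift P Q) auto
    finally show "norm (ext_integrand A B Y P Q t) \<le> h t"
      by (simp add: h_def mult_ac)
  qed
qed

lemma ext_mBeta_add_nat:
  "ext_mBeta A B Y (P + mat (of_nat n)) Q = integral {0<..<1} (\<lambda>t. t ^ n *\<^sub>R ext_integrand A B Y P Q t)"
  unfolding ext_mBeta_def integral_open_interval_real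
proof (rule integral_cong)
  fix t :: real assume t: "t \<in> {0<..<1}"
  have eq: "P + mat (of_nat n) - mat 1 = (P - mat 1) + mat (complex_of_real (real n))"
    by simp
  have "mpowr t (P + mat (of_nat n) - mat 1) = t powr real n *\<^sub>R mpowr t (P - mat 1)"
    unfolding eq by (rule mpowr_add_mat) (use t in simp)
  also have "t powr real n = t ^ n"
    using t by (simp add: powr_realpow)
  finally show "hyp1F1 A B (- ((1 / (t * (1 - t))) *\<^sub>R Y)) ** mpowr t (P + mat (of_nat n) - mat 1) ** mpowr (1 - t) (Q - mat 1)
      = t ^ n *\<^sub>R ext_integrand A B Y P Q t"
    by (simp add: ext_integrand_def mm.scaleR_left mm.scaleR_right)
qed

text \<open>The hypergeometric factor depends only on \<open>t * (1 - t)\<close>, which is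
  symmetric; the two powers trade places by commutativity.\<close>

lemma ext_integrand_reflect:
  assumes "P ** Q = Q ** P"
  shows "ext_integrand A B Y Q P (1 - t) = ext_integrand A B Y P Q t"
proof -
  have "mpowr (1 - t) (Q - mat 1) ** mpowr t (P - mat 1) = mpowr t (P - mat 1) ** mpowr (1 - t) (Q - mat 1)"
    by (rule mpowr_mpowr_commute)
      (simp add: mm.diff_left mm.diff_right assms)
  then show ?thesis
    by (simp add: ext_integrand_def mult.commute flip: matrix_mul_assoc)
qed

lemma integral_reflect_unit_interval:
  fixes f :: "real \<Rightarrow> 'a::euclidean_space"
  shows "integral {0<..<1} (\<lambda>t. f (1 - t)) = integral {0<..<1} f"
proof -
  \<comment> \<open>Reflection in 0 applied to the translate of \<open>f\<close>. As an equivalence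
    for every \<open>i\<close> it gives equal integrals also when neither exists.\<close>
  have "((\<lambda>t. f (1 - t)) has_integral i) {0..1} \<longleftrightarrow> ((\<lambda>x. f (x + 1)) has_integral i) {- 1..0}" for i
    using has_integral_reflect_real[of "\<lambda>x. f (x + 1)" i 0 "- 1"]
    by (simp del: has_integral_reflect_real)
  then have "integral {0..1} (\<lambda>t. f (1 - t)) = integral {- 1..0} (\<lambda>x. f (x + 1))"
    by (simp add: integral_def integrable_on_def)
  also have "\<dots> = integral {0..1} f"
    using integral_shift_real_ivl[of 0 1 1 f] by simp
  finally show ?thesis
    by (simp flip: integral_open_interval_real)
qed

lemma ext_mBeta_add_nat_reflect:
  assumes "P ** Q = Q ** P"
  shows "ext_mBeta A B Y (Q + mat (of_nat n)) P
    = integral {0<..<1} (\<lambda>t. (1 - t) ^ n *\<^sub>R ext_integrand A B Y P Q t)"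
  using integral_reflect_unit_interval[of "\<lambda>t. t ^ n *\<^sub>R ext_integrand A B Y Q P t"]
  by (simp add: ext_mBeta_add_nat ext_integrand_reflect[OF assms])

text \<open>Dominated convergence for the exponential series with majorant
  \<open>exp (norm w) * h t\<close>. The weight \<open>g\<close> allows both \<open>t\<close> and
  \<open>1 - t\<close>, one for each side of the transformation.\<close>

lemma exp_series_integral:
  fixes F :: "real \<Rightarrow> complex^'n^'n" and w :: complex
  assumes F: "F \<in> borel_measurable (lebesgue_on {0<..<1})" and h: "h integrable_on {0<..<1}"
    and bound: "\<And>t. 0 < t \<Longrightarrow> t < 1 \<Longrightarrow> norm (F t) \<le> h t"
    and g: "continuous_on {0<..<1} g" "\<And>t. 0 < t \<Longrightarrow> t < 1 \<Longrightarrow> \<bar>g t\<bar> \<le> 1"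
  shows "(\<lambda>t. exp (w * of_real (g t)) *\<^sub>M F t) integrable_on {0<..<1}"
    and "(\<lambda>n. (w ^ n / fact n) *\<^sub>M integral {0<..<1} (\<lambda>t. g t ^ n *\<^sub>R F t))
      sums integral {0<..<1} (\<lambda>t. exp (w * of_real (g t)) *\<^sub>M F t)"
proof -
  let ?f = "\<lambda>n t. (w ^ n / fact n) *\<^sub>M (g t ^ n *\<^sub>R F t)"
  have g_pow: "\<bar>g t\<bar> ^ n \<le> 1" if "t \<in> {0<..<1}" for t n
    using g(2)[of t] that by (simp add: power_le_one)
  have int: "(\<lambda>t. g t ^ n *\<^sub>R F t) integrable_on {0<..<1}" for n
  proof (rule integrable_on_Ioo_dominated[OF _ h])
    show "(\<lambda>t. g t ^ n *\<^sub>R F t) \<in> borel_measurable (lebesgue_on {0<..<1})"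
      by (intro borel_measurable_scaleR F continuous_imp_measurable_on_sets_lebesgue continuous_intros g) auto
    fix t :: real assume t: "0 < t" "t < 1"
    have "norm (g t ^ n *\<^sub>R F t) \<le> 1 * h t"
      unfolding norm_scaleR using t bound[of t] g_pow[of t n]
      by (intro mult_mono) (auto simp: power_abs)
    then show "norm (g t ^ n *\<^sub>R F t) \<le> h t" by simp
  qed
  have lin: "(?f n has_integral (w ^ n / fact n) *\<^sub>M integral {0<..<1} (\<lambda>t. g t ^ n *\<^sub>R F t)) {0<..<1}" for n
    using has_integral_linear[OF integrable_integral[OF int] ms.bounded_linear_right] by (simp add: o_def)
  then have 1: "?f n integrable_on {0<..<1}" for n
    by blast
  have 2: "(\<lambda>t. exp (norm w) * h t) integrable_on {0<..<1}"
    using h by (rule integrable_on_mult_right)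
  have 3: "norm (\<Sum>n<N. ?f n t) \<le> exp (norm w) * h t" if t: "t \<in> {0<..<1}" for N t
  proof -
    have h0: "h t \<ge> 0"
      using order_trans[OF norm_ge_zero bound[of t]] t by simp
    have "norm (\<Sum>n<N. ?f n t) \<le> (\<Sum>n<N. (norm w ^ n /\<^sub>R fact n) * h t)"
    proof (rule sum_norm_le)
      fix n
      have "norm (?f n t) = (norm w ^ n /\<^sub>R fact n) * (\<bar>g t\<bar> ^ n * norm (F t))"
        by (simp add: norm_mscale norm_mult norm_inverse norm_power power_abs divide_inverse mult_ac)
      also have "\<dots> \<le> (norm w ^ n /\<^sub>R fact n) * (1 * h t)"
        using t h0 bound[of t] g_pow[OF t] by (intro mult_left_mono mult_mono) auto
      finally show "norm (?f n t) \<le> (norm w ^ n /\<^sub>R fact n) * h t" by simp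
    qed
    also have "\<dots> = (\<Sum>n<N. norm w ^ n /\<^sub>R fact n) * h t"
      by (simp only: sum_distrib_right)
    also have "\<dots> \<le> exp (norm w) * h t"
      unfolding exp_def using h0 by (intro mult_right_mono sum_le_suminf summable_exp_generic) auto
    finally show ?thesis .
  qed
  have 4: "(\<lambda>n. ?f n t) sums (exp (w * of_real (g t)) *\<^sub>M F t)" for t
  proof -
    have "?f n t = ((w * of_real (g t)) ^ n /\<^sub>R fact n) *\<^sub>M F t" for n
    proof -
      have "(w ^ n / fact n) * complex_of_real (g t ^ n) = (w * of_real (g t)) ^ n /\<^sub>R fact n"
        by (simp add: scaleR_conv_of_real power_mult_distrib field_simps)
      then show ?thesis
        by (simp only: mscale_of_real[symmetric] mscale_mscale)
    qed
    then show ?thesis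
      by (simp only: bounded_linear.sums[OF ms.bounded_linear_left exp_converges])
  qed
  note dom = sums_integral_dominated[OF 1 2 3 4]
  show "(\<lambda>t. exp (w * of_real (g t)) *\<^sub>M F t) integrable_on {0<..<1}"
    by (rule dom(1))
  show "(\<lambda>n. (w ^ n / fact n) *\<^sub>M integral {0<..<1} (\<lambda>t. g t ^ n *\<^sub>R F t))
      sums integral {0<..<1} (\<lambda>t. exp (w * of_real (g t)) *\<^sub>M F t)"
    using dom(2) by (simp only: integral_unique[OF lin])
qed

section \<open>Symmetry of the beta matrix function\<close>

lemma mGamma_commute:
  assumes "P ** X = X ** P"
  shows "mGamma P ** X = X ** mGamma P"
proof (cases "(\<lambda>t. exp (- t) *\<^sub>R mpowr t (P - mat 1)) integrable_on {0..}")
  case True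
  have "(exp (- t) *\<^sub>R mpowr t (P - mat 1)) ** X = X ** (exp (- t) *\<^sub>R mpowr t (P - mat 1))" for t
    unfolding mm.scaleR_left mm.scaleR_right
    by (subst mpowr_commute) (simp_all add: mm.diff_left mm.diff_right assms)
  then show ?thesis
    using integral_linear[OF True mm.bounded_linear_left[of X]]
      integral_linear[OF True mm.bounded_linear_right[of X]]
    by (simp add: mGamma_def o_def)
next
  \<comment> \<open>A divergent integral has the value 0, which commutes with every matrix.\<close>
  case False
  then show ?thesis
    by (simp add: mGamma_def not_integrable_integral mm.zero_left mm.zero_right)
qed

text \<open>Ensures that the two extended functions of the theorem are normalised by the same
  matrix.\<close>

lemma mBeta_commute:
  assumes "P ** Q = Q ** P"
  shows "mBeta P Q = mBeta Q P"
proof -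
  have "mGamma P ** mGamma Q = mGamma Q ** mGamma P"
    by (metis assms mGamma_commute)
  then show ?thesis
    by (simp add: mBeta_def add.commute)
qed

theorem theorem4p6:
  fixes A B Y B1 C1 :: "complex^'n^'n"
    and z :: complex
  assumes "positive_stable A"
    and "positive_stable B"
    and "positive_stable Y"
    and "positive_stable B1"
    and "positive_stable C1"
    and "positive_stable (C1 - B1)"
    and "B1 ** C1 = C1 ** B1"
  shows "ext_hyp1F1 A B Y B1 C1 z = exp z *\<^sub>M ext_hyp1F1 A B Y (C1 - B1) C1 (- z)"
proof -
  define Q where "Q = C1 - B1"
  define N where "N = matrix_inv (mBeta B1 Q)"
  define F where "F = ext_integrand A B Y B1 Q"
  have comm: "B1 ** Q = Q ** B1"
    using assms(7) by (simp add: Q_def mm.diff_left mm.diff_right)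
  have Q: "positive_stable Q" and C1: "C1 - Q = B1"
    using assms(6) by (simp_all add: Q_def)
  obtain h where h: "h integrable_on {0<..<1}" "\<And>t. 0 < t \<Longrightarrow> t < 1 \<Longrightarrow> norm (ext_integrand A B Y B1 Q t) \<le> h t"
    by (rule ext_integrand_dominated[OF assms(1-4) Q], rule that)
  note h = h[folded F_def]
  have F: "F \<in> borel_measurable (lebesgue_on {0<..<1})"
    unfolding F_def by (rule ext_integrand_measurable[OF assms(1,2)])
  \<comment> \<open>Both sides are instances: \<open>w = z\<close> with \<open>g t = t\<close>, and
    \<open>w = - z\<close> with \<open>g t = 1 - t\<close>. The matrix \<open>N\<close> stays
    outside the integral on the right.\<close>
  have series: "(\<Sum>n. (w ^ n / fact n) *\<^sub>M (integral {0<..<1} (\<lambda>t. g t ^ n *\<^sub>R F t) ** N))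
      = integral {0<..<1} (\<lambda>t. exp (w * of_real (g t)) *\<^sub>M F t) ** N"
    if "continuous_on {0<..<1} g" "\<And>t. 0 < t \<Longrightarrow> t < 1 \<Longrightarrow> \<bar>g t\<bar> \<le> 1" for w g
    using bounded_linear.sums[OF mm.bounded_linear_left exp_series_integral(2)[OF F h that, of w], of N]
    by (simp add: mscale_mult_left sums_iff)
  have "ext_hyp1F1 A B Y B1 C1 z = integral {0<..<1} (\<lambda>t. exp (z * of_real t) *\<^sub>M F t) ** N"
    unfolding ext_hyp1F1_def Q_def[symmetric] N_def[symmetric] ext_mBeta_add_nat F_def[symmetric]
    by (rule series) (auto intro!: continuous_intros)
  \<comment> \<open>The heart of the transformation:
    \<open>exp (z * t) = exp z * exp (- z * (1 - t))\<close>.\<close>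
  also have "integral {0<..<1} (\<lambda>t. exp (z * of_real t) *\<^sub>M F t)
      = integral {0<..<1} (\<lambda>t. exp z *\<^sub>M (exp (- z * of_real (1 - t)) *\<^sub>M F t))"
    by (intro integral_cong) (simp add: algebra_simps flip: exp_add)
  also have "\<dots> = exp z *\<^sub>M integral {0<..<1} (\<lambda>t. exp (- z * of_real (1 - t)) *\<^sub>M F t)"
    by (rule integral_linear[OF _ ms.bounded_linear_right, unfolded o_def], rule exp_series_integral(1)[OF F h])
      (auto intro!: continuous_intros)
  \<comment> \<open>Read backwards, the weights \<open>(1 - t) ^ n\<close> are the reflected beta
    integrals with the parameters \<open>Q\<close> and \<open>C1 - Q = B1\<close>, and
    \<open>N\<close> is also the inverse of \<open>mBeta Q B1\<close>.\<close>
  also have "(exp z *\<^sub>M integral {0<..<1} (\<lambda>t. exp (- z * of_real (1 - t)) *\<^sub>M F t)) ** N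
      = exp z *\<^sub>M ext_hyp1F1 A B Y Q C1 (- z)"
    unfolding ext_hyp1F1_def C1 mscale_mult_left ext_mBeta_add_nat_reflect[OF comm] F_def[symmetric]
      mBeta_commute[OF comm[symmetric]] N_def[symmetric]
    by (rule arg_cong[where f = "(*\<^sub>M) (exp z)"], rule series[symmetric]) (auto intro!: continuous_intros)
  finally show ?thesis
    unfolding Q_def .
qed

end
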